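(* The system $\mathsf{P}_0+\mathsf{SOT}+\mathsf{STP}_2$ proves $[\Sigma^2_1\text{-}\mathsf{SEP}]^{\mathrm{st}}$.
   Context: $\mathsf P_0=\mathsf{E\text{-}PRA}^{\omega*}+\mathsf{QF\text{-}AC}^{1,0}+\mathcal T^*_{\mathrm{st}}+\mathsf I+\mathsf{HAC}_{\mathrm{int}}$ in the language of finite types with finite-sequence types $\rho^*$ and predicates $\mathrm{st}$ (internal = st-free); $\mathcal T^*_{\mathrm{st}}$: $\mathrm{st}(x)\wedge x=y\to\mathrm{st}(y)$, $\mathrm{st}(t)$ for closed terms $t$, $\mathrm{st}(f)\wedge\mathrm{st}(x)\to\mathrm{st}(f(x))$; $\mathsf I$: for internal $\varphi$, $(\forall^{\mathrm{st}}x^{\sigma^*})(\exists y)(\forall z\in x)\varphi(z,y)\to(\exists y)(\forall^{\mathrm{st}}x^\sigma)\varphi(x,y)$; $\mathsf{HAC}_{\mathrm{int}}$: for internal $\varphi$, $(\forall^{\mathrm{st}}x^\rho)(\exists^{\mathrm{st}}y^\tau)\varphi(x,y)\to(\exists^{\mathrm{st}}F^{\rho\to\tau^*})(\forall^{\mathrm{st}}x)(\exists y\in F(x))\varphi(x,y)$. $\mathsf{SOT}$: $(\forall^{\mathrm{st}}Y^2)[(\exists f^1)(Y(f)=0)\to(\exists^{\mathrm{st}}f^1)(Y(f)=0)]$. $\mathsf{STP}_2$: $(\forall Y^2\le_2 1)(\exists^{\mathrm{st}}Z^2\le_21)(\forall^{\mathrm{st}}g^1)(Z(g)=Y(g))$.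 $\Sigma^2_1\text{-}\mathsf{SEP}$: for $\varphi_1,\varphi_2\in\Sigma^2_1$ (formulas of the form $(\exists Y^2)(\forall f_i^1)(\psi(Y,f_i,f)=0)$ with $\psi$ of type 3, possibly with parameters) not involving $Z$: $(\forall f^1)(\neg\varphi_1(f)\vee\neg\varphi_2(f))\to(\exists Z^2)(\forall f^1)(\varphi_1(f)\to Z(f)=1\wedge\varphi_2(f)\to Z(f)=0)$. $A^{\mathrm{st}}$ denotes $A$ with all quantifiers relativised to $\mathrm{st}$. *)

theory Defs
  imports Main
begin

section \<open>Language\<close>

text \<open>Finite types over \<open>TN\<close> (type 0), closed under function types and
  finite-sequence types (\<open>Seq \<sigma>\<close> is \<open>\<sigma>*\<close>).\<close>

datatype ty = TN | Fn ty ty (infixr "\<leadsto>" 60) | Seq ty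

abbreviation T1 :: ty where "T1 \<equiv> TN \<leadsto> TN"
abbreviation T2 :: ty where "T2 \<equiv> T1 \<leadsto> TN"

text \<open>A variable carries its type, so no typing contexts are needed.\<close>

type_synonym var = "nat \<times> ty"

text \<open>The sequence constants are: empty sequence, prefixing of an element, length, projection
  \<open>(s)\<^sub>i\<close>, tabulation \<open>f, n \<mapsto> \<langle>f 0, \<dots>, f (n - 1)\<rangle>\<close> and the list recursor.  Like the
  recursor \<open>R\<^sub>0\<close>, the list recursor only has result type 0; list recursion into higher types
  would define all of Goedel's primitive recursive functionals.  All six are explicitly
  definable if a sequence is coded by its length together with its enumerating function, so that
  they only amount to a definitional extension of E-PRA\<open>\<^sup>\<omega>\<close>.\<close>

datatype const =
    CZero
  | CSucc
  | CK ty ty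
  | CS ty ty ty
  | CRec
  | CNil ty
  | CCons ty
  | CLen ty
  | CProj ty
  | CTab ty
  | CLRec ty

primrec ctype :: "const \<Rightarrow> ty" where
  "ctype CZero = TN"
| "ctype CSucc = TN \<leadsto> TN"
| "ctype (CK \<sigma> \<tau>) = \<sigma> \<leadsto> \<tau> \<leadsto> \<sigma>"
| "ctype (CS \<rho> \<sigma> \<tau>) = (\<rho> \<leadsto> \<sigma> \<leadsto> \<tau>) \<leadsto> (\<rho> \<leadsto> \<sigma>) \<leadsto> \<rho> \<leadsto> \<tau>"
| "ctype CRec = TN \<leadsto> TN \<leadsto> (TN \<leadsto> TN \<leadsto> TN) \<leadsto> TN"
| "ctype (CNil \<sigma>) = Seq \<sigma>"
| "ctype (CCons \<sigma>) = \<sigma> \<leadsto> Seq \<sigma> \<leadsto> Seq \<sigma>"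
| "ctype (CLen \<sigma>) = Seq \<sigma> \<leadsto> TN"
| "ctype (CProj \<sigma>) = Seq \<sigma> \<leadsto> TN \<leadsto> \<sigma>"
| "ctype (CTab \<sigma>) = (TN \<leadsto> \<sigma>) \<leadsto> TN \<leadsto> Seq \<sigma>"
| "ctype (CLRec \<sigma>) = Seq \<sigma> \<leadsto> TN \<leadsto> (TN \<leadsto> \<sigma> \<leadsto> TN) \<leadsto> TN"

datatype trm = Var var | Con const | App trm trm (infixl "\<cdot>" 300)

primrec tyof :: "trm \<Rightarrow> ty option" where
  "tyof (Var v) = Some (snd v)"
| "tyof (Con c) = Some (ctype c)"
| "tyof (t \<cdot> u) =
     (case tyof t of
        Some (\<sigma> \<leadsto> \<tau>) \<Rightarrow> if tyof u = Some \<sigma> then Some \<tau> else None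
      | _ \<Rightarrow> None)"

abbreviation has_type :: "trm \<Rightarrow> ty \<Rightarrow> bool" (infix "\<Colon>" 50) where
  "t \<Colon> \<sigma> \<equiv> tyof t = Some \<sigma>"

primrec fvt :: "trm \<Rightarrow> var set" where
  "fvt (Var v) = {v}"
| "fvt (Con c) = {}"
| "fvt (t \<cdot> u) = fvt t \<union> fvt u"

primrec subst_t :: "var \<Rightarrow> trm \<Rightarrow> trm \<Rightarrow> trm" where
  "subst_t x s (Var v) = (if v = x then s else Var v)"
| "subst_t x s (Con c) = Con c"
| "subst_t x s (t \<cdot> u) = subst_t x s t \<cdot> subst_t x s u"

text \<open>The only primitive equality is that of type 0.\<close>

datatype fm =
    Eq trm trm (infix "\<^bold>=" 50)
  | St trm
  | Bot ("\<^bold>\<bottom>")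
  | Imp fm fm (infixr "\<^bold>\<longrightarrow>" 25)
  | And fm fm (infixr "\<^bold>\<and>" 35)
  | Or fm fm (infixr "\<^bold>\<or>" 30)
  | All var fm ("(3\<^bold>\<forall>_./ _)" [1000, 10] 10)
  | Ex var fm ("(3\<^bold>\<exists>_./ _)" [1000, 10] 10)

abbreviation Neg :: "fm \<Rightarrow> fm" ("\<^bold>\<not> _" [40] 40) where
  "\<^bold>\<not> A \<equiv> A \<^bold>\<longrightarrow> \<^bold>\<bottom>"

abbreviation AllSt :: "var \<Rightarrow> fm \<Rightarrow> fm" ("(3\<^bold>\<forall>\<^sup>s\<^sup>t_./ _)" [1000, 10] 10) where
  "\<^bold>\<forall>\<^sup>s\<^sup>tx. A \<equiv> \<^bold>\<forall>x. (St (Var x) \<^bold>\<longrightarrow> A)"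

abbreviation ExSt :: "var \<Rightarrow> fm \<Rightarrow> fm" ("(3\<^bold>\<exists>\<^sup>s\<^sup>t_./ _)" [1000, 10] 10) where
  "\<^bold>\<exists>\<^sup>s\<^sup>tx. A \<equiv> \<^bold>\<exists>x. (St (Var x) \<^bold>\<and> A)"

primrec wff :: "fm \<Rightarrow> bool" where
  "wff (s \<^bold>= t) = (s \<Colon> TN \<and> t \<Colon> TN)"
| "wff (St t) = (\<exists>\<sigma>. t \<Colon> \<sigma>)"
| "wff \<^bold>\<bottom> = True"
| "wff (A \<^bold>\<longrightarrow> B) = (wff A \<and> wff B)"
| "wff (A \<^bold>\<and> B) = (wff A \<and> wff B)"
| "wff (A \<^bold>\<or> B) = (wff A \<and> wff B)"
| "wff (\<^bold>\<forall>x. A) = wff A"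
| "wff (\<^bold>\<exists>x. A) = wff A"

primrec fv :: "fm \<Rightarrow> var set" where
  "fv (s \<^bold>= t) = fvt s \<union> fvt t"
| "fv (St t) = fvt t"
| "fv \<^bold>\<bottom> = {}"
| "fv (A \<^bold>\<longrightarrow> B) = fv A \<union> fv B"
| "fv (A \<^bold>\<and> B) = fv A \<union> fv B"
| "fv (A \<^bold>\<or> B) = fv A \<union> fv B"
| "fv (\<^bold>\<forall>x. A) = fv A - {x}"
| "fv (\<^bold>\<exists>x. A) = fv A - {x}"

text \<open>Substitution does not rename bound variables; \<open>free_for s x A\<close> says that no free variable
  of \<open>s\<close> is captured in \<open>subst x s A\<close>.\<close>

primrec subst :: "var \<Rightarrow> trm \<Rightarrow> fm \<Rightarrow> fm" where
  "subst x s (t \<^bold>= u) = (subst_t x s t \<^bold>= subst_t x s u)"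
| "subst x s (St t) = St (subst_t x s t)"
| "subst x s \<^bold>\<bottom> = \<^bold>\<bottom>"
| "subst x s (A \<^bold>\<longrightarrow> B) = (subst x s A \<^bold>\<longrightarrow> subst x s B)"
| "subst x s (A \<^bold>\<and> B) = (subst x s A \<^bold>\<and> subst x s B)"
| "subst x s (A \<^bold>\<or> B) = (subst x s A \<^bold>\<or> subst x s B)"
| "subst x s (\<^bold>\<forall>y. A) = (\<^bold>\<forall>y. (if y = x then A else subst x s A))"
| "subst x s (\<^bold>\<exists>y. A) = (\<^bold>\<exists>y. (if y = x then A else subst x s A))"

primrec free_for :: "trm \<Rightarrow> var \<Rightarrow> fm \<Rightarrow> bool" where
  "free_for s x (t \<^bold>= u) = True"
| "free_for s x (St t) = True"
| "free_for s x \<^bold>\<bottom> = True"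
| "free_for s x (A \<^bold>\<longrightarrow> B) = (free_for s x A \<and> free_for s x B)"
| "free_for s x (A \<^bold>\<and> B) = (free_for s x A \<and> free_for s x B)"
| "free_for s x (A \<^bold>\<or> B) = (free_for s x A \<and> free_for s x B)"
| "free_for s x (\<^bold>\<forall>y. A) = (x \<notin> fv (\<^bold>\<forall>y. A) \<or> y \<notin> fvt s \<and> free_for s x A)"
| "free_for s x (\<^bold>\<exists>y. A) = (x \<notin> fv (\<^bold>\<exists>y. A) \<or> y \<notin> fvt s \<and> free_for s x A)"

primrec internal :: "fm \<Rightarrow> bool" where
  "internal (s \<^bold>= t) = True"
| "internal (St t) = False"
| "internal \<^bold>\<bottom> = True"
| "internal (A \<^bold>\<longrightarrow> B) = (internal A \<and> internal B)"
| "internal (A \<^bold>\<and> B) = (internal A \<and> internal B)"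
| "internal (A \<^bold>\<or> B) = (internal A \<and> internal B)"
| "internal (\<^bold>\<forall>x. A) = internal A"
| "internal (\<^bold>\<exists>x. A) = internal A"

text \<open>Quantifier-free internal formulas.\<close>

primrec qf :: "fm \<Rightarrow> bool" where
  "qf (s \<^bold>= t) = True"
| "qf (St t) = False"
| "qf \<^bold>\<bottom> = True"
| "qf (A \<^bold>\<longrightarrow> B) = (qf A \<and> qf B)"
| "qf (A \<^bold>\<and> B) = (qf A \<and> qf B)"
| "qf (A \<^bold>\<or> B) = (qf A \<and> qf B)"
| "qf (\<^bold>\<forall>x. A) = False"
| "qf (\<^bold>\<exists>x. A) = False"

text \<open>\<open>A\<^sup>s\<^sup>t\<close>: all quantifiers relativised to \<open>st\<close>.\<close>

primrec relst :: "fm \<Rightarrow> fm" where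
  "relst (s \<^bold>= t) = (s \<^bold>= t)"
| "relst (St t) = St t"
| "relst \<^bold>\<bottom> = \<^bold>\<bottom>"
| "relst (A \<^bold>\<longrightarrow> B) = (relst A \<^bold>\<longrightarrow> relst B)"
| "relst (A \<^bold>\<and> B) = (relst A \<^bold>\<and> relst B)"
| "relst (A \<^bold>\<or> B) = (relst A \<^bold>\<or> relst B)"
| "relst (\<^bold>\<forall>x. A) = (\<^bold>\<forall>\<^sup>s\<^sup>tx. relst A)"
| "relst (\<^bold>\<exists>x. A) = (\<^bold>\<exists>\<^sup>s\<^sup>tx. relst A)"

text \<open>Universal closures.  The order of the quantifiers is immaterial, so every list of variables
  that closes the formula is admitted.\<close>

definition closures :: "fm set \<Rightarrow> fm set" where
  "closures X = {foldr All xs A | xs A. A \<in> X \<and> fv (foldr All xs A) = {}}"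


section \<open>Classical many-sorted predicate logic\<close>

text \<open>Natural deduction.  The equality axioms are among the axioms of E-PRA\<open>\<^sup>\<omega>\<^sup>*\<close>.\<close>

inductive proves :: "fm set \<Rightarrow> fm \<Rightarrow> bool" (infix "\<turnstile>" 5) where
  Assm: "\<lbrakk>A \<in> \<Gamma>; wff A\<rbrakk> \<Longrightarrow> \<Gamma> \<turnstile> A"
| ImpI: "\<lbrakk>wff A; insert A \<Gamma> \<turnstile> B\<rbrakk> \<Longrightarrow> \<Gamma> \<turnstile> A \<^bold>\<longrightarrow> B"
| ImpE: "\<lbrakk>\<Gamma> \<turnstile> A \<^bold>\<longrightarrow> B; \<Gamma> \<turnstile> A\<rbrakk> \<Longrightarrow> \<Gamma> \<turnstile> B"
| AndI: "\<lbrakk>\<Gamma> \<turnstile> A; \<Gamma> \<turnstile> B\<rbrakk> \<Longrightarrow> \<Gamma> \<turnstile> A \<^bold>\<and> B"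
| AndE1: "\<Gamma> \<turnstile> A \<^bold>\<and> B \<Longrightarrow> \<Gamma> \<turnstile> A"
| AndE2: "\<Gamma> \<turnstile> A \<^bold>\<and> B \<Longrightarrow> \<Gamma> \<turnstile> B"
| OrI1: "\<lbrakk>\<Gamma> \<turnstile> A; wff B\<rbrakk> \<Longrightarrow> \<Gamma> \<turnstile> A \<^bold>\<or> B"
| OrI2: "\<lbrakk>\<Gamma> \<turnstile> B; wff A\<rbrakk> \<Longrightarrow> \<Gamma> \<turnstile> A \<^bold>\<or> B"
| OrE: "\<lbrakk>\<Gamma> \<turnstile> A \<^bold>\<or> B; insert A \<Gamma> \<turnstile> C; insert B \<Gamma> \<turnstile> C\<rbrakk> \<Longrightarrow> \<Gamma> \<turnstile> C"
| Classical: "\<lbrakk>wff A; insert (\<^bold>\<not> A) \<Gamma> \<turnstile> \<^bold>\<bottom>\<rbrakk> \<Longrightarrow> \<Gamma> \<turnstile> A"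
| AllI: "\<lbrakk>\<Gamma> \<turnstile> A; x \<notin> \<Union> (fv ` \<Gamma>)\<rbrakk> \<Longrightarrow> \<Gamma> \<turnstile> \<^bold>\<forall>x. A"
| AllE: "\<lbrakk>\<Gamma> \<turnstile> \<^bold>\<forall>x. A; t \<Colon> snd x; free_for t x A\<rbrakk> \<Longrightarrow> \<Gamma> \<turnstile> subst x t A"
| ExI: "\<lbrakk>\<Gamma> \<turnstile> subst x t A; wff A; t \<Colon> snd x; free_for t x A\<rbrakk> \<Longrightarrow> \<Gamma> \<turnstile> \<^bold>\<exists>x. A"
| ExE: "\<lbrakk>\<Gamma> \<turnstile> \<^bold>\<exists>x. A; insert A \<Gamma> \<turnstile> C; x \<notin> \<Union> (fv ` \<Gamma>) \<union> fv C\<rbrakk> \<Longrightarrow> \<Gamma> \<turnstile> C"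


section \<open>Defined terms and formulas\<close>

text \<open>Abstraction \<open>\<lambda>v. t\<close>, defined by the combinators.\<close>

primrec lam :: "var \<Rightarrow> trm \<Rightarrow> trm" where
  "lam v (Var w) =
     (if w = v
      then Con (CS (snd v) (snd v \<leadsto> snd v) (snd v))
             \<cdot> Con (CK (snd v) (snd v \<leadsto> snd v)) \<cdot> Con (CK (snd v) (snd v))
      else Con (CK (snd w) (snd v)) \<cdot> Var w)"
| "lam v (Con c) = Con (CK (ctype c) (snd v)) \<cdot> Con c"
| "lam v (t \<cdot> u) =
     Con (CS (snd v) (the (tyof u)) (the (tyof (t \<cdot> u)))) \<cdot> lam v t \<cdot> lam v u"

abbreviation zero :: trm where "zero \<equiv> Con CZero"
abbreviation suc :: "trm \<Rightarrow> trm" where "suc t \<equiv> Con CSucc \<cdot> t"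
abbreviation one :: trm where "one \<equiv> suc zero"

abbreviation len :: "ty \<Rightarrow> trm \<Rightarrow> trm" where "len \<sigma> s \<equiv> Con (CLen \<sigma>) \<cdot> s"
abbreviation proj :: "ty \<Rightarrow> trm \<Rightarrow> trm \<Rightarrow> trm" where "proj \<sigma> s i \<equiv> Con (CProj \<sigma>) \<cdot> s \<cdot> i"

text \<open>\<open>R\<^sub>0 0 y z = y\<close> and \<open>R\<^sub>0 (n + 1) y z = z (R\<^sub>0 n y z) n\<close>; hence \<open>predec\<close> is the closed term for
  the predecessor, and \<open>monus s t\<close> is cut-off subtraction.\<close>

definition predec :: trm where
  "predec = lam (0, TN) (Con CRec \<cdot> Var (0, TN) \<cdot> zero \<cdot> lam (1, TN) (lam (2, TN) (Var (2, TN))))"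

definition monus :: "trm \<Rightarrow> trm \<Rightarrow> trm" where
  "monus s t = Con CRec \<cdot> t \<cdot> s \<cdot> lam (0, TN) (lam (1, TN) (predec \<cdot> Var (0, TN)))"

definition le :: "trm \<Rightarrow> trm \<Rightarrow> fm" (infix "\<^bold>\<le>" 50) where
  "(s \<^bold>\<le> t) = (monus s t \<^bold>= zero)"

definition lt :: "trm \<Rightarrow> trm \<Rightarrow> fm" (infix "\<^bold><" 50) where
  "(s \<^bold>< t) = (suc s \<^bold>\<le> t)"

definition fresh :: "var set \<Rightarrow> nat" where
  "fresh V = (LEAST n. n \<notin> fst ` V)"

text \<open>Equality of arbitrary type: extensional for functions, and equality of length and of all
  entries for finite sequences.\<close>

fun eq :: "ty \<Rightarrow> trm \<Rightarrow> trm \<Rightarrow> fm" where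
  "eq TN s t = (s \<^bold>= t)"
| "eq (\<sigma> \<leadsto> \<tau>) s t =
     (let x = (fresh (fvt s \<union> fvt t), \<sigma>) in \<^bold>\<forall>x. eq \<tau> (s \<cdot> Var x) (t \<cdot> Var x))"
| "eq (Seq \<sigma>) s t =
     (let i = (fresh (fvt s \<union> fvt t), TN) in
        (len \<sigma> s \<^bold>= len \<sigma> t) \<^bold>\<and>
        (\<^bold>\<forall>i. ((Var i \<^bold>< len \<sigma> s) \<^bold>\<longrightarrow> eq \<sigma> (proj \<sigma> s (Var i)) (proj \<sigma> t (Var i)))))"

definition mem :: "ty \<Rightarrow> trm \<Rightarrow> trm \<Rightarrow> fm" where
  "mem \<sigma> z s =
     (let i = (fresh (fvt z \<union> fvt s), TN) in
        \<^bold>\<exists>i. ((Var i \<^bold>< len \<sigma> s) \<^bold>\<and> eq \<sigma> z (proj \<sigma> s (Var i))))"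

text \<open>The zero object of each type, the default value of projection.\<close>

primrec zero_of :: "ty \<Rightarrow> trm" where
  "zero_of TN = zero"
| "zero_of (\<sigma> \<leadsto> \<tau>) = Con (CK \<tau> \<sigma>) \<cdot> zero_of \<tau>"
| "zero_of (Seq \<sigma>) = Con (CNil \<sigma>)"


section \<open>The system \<open>P\<^sub>0\<close>\<close>

inductive_set EPRA :: "fm set" where
  eq_refl: "s \<Colon> TN \<Longrightarrow> (s \<^bold>= s) \<in> EPRA"
| eq_euclid: "\<lbrakk>s \<Colon> TN; t \<Colon> TN; u \<Colon> TN\<rbrakk> \<Longrightarrow> (s \<^bold>= t \<^bold>\<longrightarrow> s \<^bold>= u \<^bold>\<longrightarrow> t \<^bold>= u) \<in> EPRA"
| ext: "\<lbrakk>s \<Colon> \<sigma>; t \<Colon> \<sigma>; u \<Colon> \<sigma> \<leadsto> \<tau>\<rbrakk> \<Longrightarrow> (eq \<sigma> s t \<^bold>\<longrightarrow> eq \<tau> (u \<cdot> s) (u \<cdot> t)) \<in> EPRA"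
| suc_nonzero: "s \<Colon> TN \<Longrightarrow> (\<^bold>\<not> (suc s \<^bold>= zero)) \<in> EPRA"
| suc_inj: "\<lbrakk>s \<Colon> TN; t \<Colon> TN\<rbrakk> \<Longrightarrow> (suc s \<^bold>= suc t \<^bold>\<longrightarrow> s \<^bold>= t) \<in> EPRA"
| K: "\<lbrakk>s \<Colon> \<sigma>; t \<Colon> \<tau>\<rbrakk> \<Longrightarrow> eq \<sigma> (Con (CK \<sigma> \<tau>) \<cdot> s \<cdot> t) s \<in> EPRA"
| S: "\<lbrakk>s \<Colon> \<rho> \<leadsto> \<sigma> \<leadsto> \<tau>; t \<Colon> \<rho> \<leadsto> \<sigma>; u \<Colon> \<rho>\<rbrakk>
      \<Longrightarrow> eq \<tau> (Con (CS \<rho> \<sigma> \<tau>) \<cdot> s \<cdot> t \<cdot> u) (s \<cdot> u \<cdot> (t \<cdot> u)) \<in> EPRA"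
| rec_zero: "\<lbrakk>y \<Colon> TN; z \<Colon> TN \<leadsto> TN \<leadsto> TN\<rbrakk> \<Longrightarrow> (Con CRec \<cdot> zero \<cdot> y \<cdot> z \<^bold>= y) \<in> EPRA"
| rec_suc: "\<lbrakk>n \<Colon> TN; y \<Colon> TN; z \<Colon> TN \<leadsto> TN \<leadsto> TN\<rbrakk>
      \<Longrightarrow> (Con CRec \<cdot> suc n \<cdot> y \<cdot> z \<^bold>= z \<cdot> (Con CRec \<cdot> n \<cdot> y \<cdot> z) \<cdot> n) \<in> EPRA"
| qf_induction: "\<lbrakk>qf A; wff A; snd x = TN\<rbrakk>
      \<Longrightarrow> (subst x zero A \<^bold>\<and> (\<^bold>\<forall>x. (A \<^bold>\<longrightarrow> subst x (suc (Var x)) A)) \<^bold>\<longrightarrow> (\<^bold>\<forall>x. A)) \<in> EPRA"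
| len_nil: "(len \<sigma> (Con (CNil \<sigma>)) \<^bold>= zero) \<in> EPRA"
| len_cons: "\<lbrakk>a \<Colon> \<sigma>; s \<Colon> Seq \<sigma>\<rbrakk>
      \<Longrightarrow> (len \<sigma> (Con (CCons \<sigma>) \<cdot> a \<cdot> s) \<^bold>= suc (len \<sigma> s)) \<in> EPRA"
| proj_cons_zero: "\<lbrakk>a \<Colon> \<sigma>; s \<Colon> Seq \<sigma>\<rbrakk>
      \<Longrightarrow> eq \<sigma> (proj \<sigma> (Con (CCons \<sigma>) \<cdot> a \<cdot> s) zero) a \<in> EPRA"
| proj_cons_suc: "\<lbrakk>a \<Colon> \<sigma>; s \<Colon> Seq \<sigma>; i \<Colon> TN\<rbrakk>
      \<Longrightarrow> eq \<sigma> (proj \<sigma> (Con (CCons \<sigma>) \<cdot> a \<cdot> s) (suc i)) (proj \<sigma> s i) \<in> EPRA"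
| proj_default: "\<lbrakk>s \<Colon> Seq \<sigma>; i \<Colon> TN\<rbrakk>
      \<Longrightarrow> (len \<sigma> s \<^bold>\<le> i \<^bold>\<longrightarrow> eq \<sigma> (proj \<sigma> s i) (zero_of \<sigma>)) \<in> EPRA"
| len_tab: "\<lbrakk>f \<Colon> TN \<leadsto> \<sigma>; n \<Colon> TN\<rbrakk> \<Longrightarrow> (len \<sigma> (Con (CTab \<sigma>) \<cdot> f \<cdot> n) \<^bold>= n) \<in> EPRA"
| proj_tab: "\<lbrakk>f \<Colon> TN \<leadsto> \<sigma>; n \<Colon> TN; i \<Colon> TN\<rbrakk>
      \<Longrightarrow> (i \<^bold>< n \<^bold>\<longrightarrow> eq \<sigma> (proj \<sigma> (Con (CTab \<sigma>) \<cdot> f \<cdot> n) i) (f \<cdot> i)) \<in> EPRA"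
| lrec_nil: "\<lbrakk>y \<Colon> TN; z \<Colon> TN \<leadsto> \<sigma> \<leadsto> TN\<rbrakk>
      \<Longrightarrow> (Con (CLRec \<sigma>) \<cdot> Con (CNil \<sigma>) \<cdot> y \<cdot> z \<^bold>= y) \<in> EPRA"
| lrec_cons: "\<lbrakk>a \<Colon> \<sigma>; s \<Colon> Seq \<sigma>; y \<Colon> TN; z \<Colon> TN \<leadsto> \<sigma> \<leadsto> TN\<rbrakk>
      \<Longrightarrow> (Con (CLRec \<sigma>) \<cdot> (Con (CCons \<sigma>) \<cdot> a \<cdot> s) \<cdot> y \<cdot> z
            \<^bold>= z \<cdot> (Con (CLRec \<sigma>) \<cdot> s \<cdot> y \<cdot> z) \<cdot> a) \<in> EPRA"

text \<open>\<open>QF-AC\<close> for types 1, 0.\<close>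

inductive_set QFAC10 :: "fm set" where
  "\<lbrakk>qf A; wff A; snd f = T1; snd n = TN; snd F = T2; F \<notin> fv A\<rbrakk>
   \<Longrightarrow> ((\<^bold>\<forall>f. \<^bold>\<exists>n. A) \<^bold>\<longrightarrow> (\<^bold>\<exists>F. \<^bold>\<forall>f. subst n (Var F \<cdot> Var f) A)) \<in> QFAC10"

inductive_set Tst :: "fm set" where
  st_eq: "\<lbrakk>s \<Colon> \<sigma>; t \<Colon> \<sigma>\<rbrakk> \<Longrightarrow> (St s \<^bold>\<and> eq \<sigma> s t \<^bold>\<longrightarrow> St t) \<in> Tst"
| st_closed: "\<lbrakk>t \<Colon> \<sigma>; fvt t = {}\<rbrakk> \<Longrightarrow> St t \<in> Tst"
| st_app: "\<lbrakk>s \<Colon> \<sigma> \<leadsto> \<tau>; t \<Colon> \<sigma>\<rbrakk> \<Longrightarrow> (St s \<^bold>\<and> St t \<^bold>\<longrightarrow> St (s \<cdot> t)) \<in> Tst"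

text \<open>Idealisation.\<close>

inductive_set Ideal :: "fm set" where
  "\<lbrakk>internal A; wff A; snd z = \<sigma>; snd x = Seq \<sigma>; x \<noteq> y; z \<noteq> y; x \<notin> fv A\<rbrakk>
   \<Longrightarrow> ((\<^bold>\<forall>\<^sup>s\<^sup>tx. \<^bold>\<exists>y. \<^bold>\<forall>z. (mem \<sigma> (Var z) (Var x) \<^bold>\<longrightarrow> A)) \<^bold>\<longrightarrow> (\<^bold>\<exists>y. \<^bold>\<forall>\<^sup>s\<^sup>tz. A)) \<in> Ideal"

text \<open>Herbrandised axiom of choice.\<close>

inductive_set HACint :: "fm set" where
  "\<lbrakk>internal A; wff A; snd x = \<rho>; snd y = \<tau>; snd F = \<rho> \<leadsto> Seq \<tau>; x \<noteq> y; F \<notin> fv A\<rbrakk>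
   \<Longrightarrow> ((\<^bold>\<forall>\<^sup>s\<^sup>tx. \<^bold>\<exists>\<^sup>s\<^sup>ty. A) \<^bold>\<longrightarrow>
        (\<^bold>\<exists>\<^sup>s\<^sup>tF. \<^bold>\<forall>\<^sup>s\<^sup>tx. \<^bold>\<exists>y. (mem \<tau> (Var y) (Var F \<cdot> Var x) \<^bold>\<and> A))) \<in> HACint"

definition P0 :: "fm set" where
  "P0 = closures (EPRA \<union> QFAC10 \<union> Tst \<union> Ideal \<union> HACint)"


section \<open>\<open>SOT\<close>, \<open>STP\<^sub>2\<close> and separation\<close>

definition SOT :: fm where
  "SOT = (let Y = (0, T2); f = (0, T1) in
     \<^bold>\<forall>\<^sup>s\<^sup>tY. ((\<^bold>\<exists>f. Var Y \<cdot> Var f \<^bold>= zero) \<^bold>\<longrightarrow> (\<^bold>\<exists>\<^sup>s\<^sup>tf. Var Y \<cdot> Var f \<^bold>= zero)))"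

text \<open>\<open>Y \<le>\<^sub>2 1\<close>, pointwise.\<close>

definition le2_one :: "var \<Rightarrow> fm" where
  "le2_one Y = (let f = (0, T1) in \<^bold>\<forall>f. Var Y \<cdot> Var f \<^bold>\<le> one)"

definition STP2 :: fm where
  "STP2 = (let Y = (0, T2); Z = (1, T2); g = (0, T1) in
     \<^bold>\<forall>Y. (le2_one Y \<^bold>\<longrightarrow>
       (\<^bold>\<exists>\<^sup>s\<^sup>tZ. (le2_one Z \<^bold>\<and> (\<^bold>\<forall>\<^sup>s\<^sup>tg. Var Z \<cdot> Var g \<^bold>= Var Y \<cdot> Var g)))))"

text \<open>\<open>Sigma21 f\<close> is the set of formulas \<open>\<exists>Y\<^sup>2 \<forall>h\<^sup>1 (\<psi>(Y, h, f) = 0)\<close>.  The free variables of \<open>\<psi>\<close>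
  are the parameters; they may be of any type.\<close>

inductive_set Sigma21 :: "var \<Rightarrow> fm set" for f :: var where
  "\<lbrakk>\<psi> \<Colon> T2 \<leadsto> T1 \<leadsto> T1 \<leadsto> TN; snd Y = T2; snd h = T1; snd f = T1; h \<noteq> f;
    Y \<notin> fvt \<psi>; h \<notin> fvt \<psi>; f \<notin> fvt \<psi>\<rbrakk>
   \<Longrightarrow> (\<^bold>\<exists>Y. \<^bold>\<forall>h. \<psi> \<cdot> Var Y \<cdot> Var h \<cdot> Var f \<^bold>= zero) \<in> Sigma21 f"

inductive_set Sigma21_SEP_inst :: "fm set" where
  "\<lbrakk>\<phi>\<^sub>1 \<in> Sigma21 f; \<phi>\<^sub>2 \<in> Sigma21 f; snd Z = T2; Z \<notin> fv \<phi>\<^sub>1 \<union> fv \<phi>\<^sub>2\<rbrakk>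
   \<Longrightarrow> ((\<^bold>\<forall>f. (\<^bold>\<not> \<phi>\<^sub>1 \<^bold>\<or> \<^bold>\<not> \<phi>\<^sub>2)) \<^bold>\<longrightarrow>
        (\<^bold>\<exists>Z. \<^bold>\<forall>f. ((\<phi>\<^sub>1 \<^bold>\<longrightarrow> Var Z \<cdot> Var f \<^bold>= one) \<^bold>\<and> (\<phi>\<^sub>2 \<^bold>\<longrightarrow> Var Z \<cdot> Var f \<^bold>= zero))))
       \<in> Sigma21_SEP_inst"

definition Sigma21_SEP :: "fm set" where
  "Sigma21_SEP = closures Sigma21_SEP_inst"

end

theory Submission
  imports Defs "HOL-Library.Countable"
begin

text \<open>By a Henkin completeness theorem for the calculus, it suffices to verify the relativised
  separation principle in all models of \<open>P\<^sub>0 + SOT + STP\<^sub>2\<close>, and after passing to the quotient by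
  extensional equality one may assume that equality of every type is true identity.  Let \<open>p\<close> and \<open>q\<close> be the
  standard matrices of the two \<open>\<Sigma>\<close>-formulas.  Idealisation yields a sequence \<open>t\<close> containing all
  standard \<open>h\<close> of type 1.  For standard \<open>Y\<close> and \<open>f\<close> the condition that \<open>p Y h f = 0\<close> for all standard
  \<open>h\<close> is by \<open>SOT\<close> equivalent to the decidable condition that \<open>p Y h f = 0\<close> for all \<open>h\<close> in \<open>t\<close>.  Idealisation
  also yields a sequence \<open>s\<close> that contains all standard \<open>Y\<close> of type 2 and for no standard \<open>f\<close>
  contains both a witness for \<open>p\<close> and one for \<open>q\<close>.  The characteristic functional of \<open>f\<close> having a
  \<open>p\<close>-witness in \<open>s\<close> separates, and \<open>STP\<^sub>2\<close> replaces it by a standard functional.\<close>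

section \<open>Syntax\<close>

text \<open>Disjointness is a hypothesis about standard witnesses, whereas an idealised sequence
  also has nonstandard members; a nonstandard one passing the test for p might sit beside a standard
  witness for q. The remedy rests on standard sequences. If all members of a standard x are
  standard, disjointness rules out a conflict inside x, so x itself meets the internal no-conflict
  condition, and idealisation passes that condition on to s. That members of a standard sequence are
  standard is the main obstacle, because the only induction is internal and quantifier-free; it is
  obtained from SOT and STP2 together. SOT otherwise acts as transfer, by contraposition: a
  counterexample to a standard matrix yields a standard counterexample. The detour through models
  spares formal derivations: once equality of every type is identity, combinator terms are evaluated
  by rewriting, and decidable conditions become functionals built from cut-off subtraction and
  bounded search.\<close>

instance ty :: countable by countable_datatype
instance const :: countable by countable_datatype
instance trm :: countable by countable_datatype
instance fm :: countable by countable_datatype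

primrec bv :: "fm \<Rightarrow> var set" where
  "bv (s \<^bold>= t) = {}"
| "bv (St t) = {}"
| "bv \<^bold>\<bottom> = {}"
| "bv (A \<^bold>\<longrightarrow> B) = bv A \<union> bv B"
| "bv (A \<^bold>\<and> B) = bv A \<union> bv B"
| "bv (A \<^bold>\<or> B) = bv A \<union> bv B"
| "bv (\<^bold>\<forall>x. A) = insert x (bv A)"
| "bv (\<^bold>\<exists>x. A) = insert x (bv A)"

lemma finite_fvt [simp]: "finite (fvt t)"
  by (induction t) auto

lemma finite_fv [simp]: "finite (fv A)"
  by (induction A) auto

lemma finite_bv [simp]: "finite (bv A)"
  by (induction A) auto

lemma tyof_subst_t [simp]: "s \<Colon> snd x \<Longrightarrow> tyof (subst_t x s t) = tyof t"
  by (induction t) (auto split: option.splits ty.splits)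

lemma wff_subst [simp]: "s \<Colon> snd x \<Longrightarrow> wff (subst x s A) = wff A"
  by (induction A) auto

lemma subst_t_fresh: "x \<notin> fvt t \<Longrightarrow> subst_t x s t = t"
  by (induction t) auto

lemma subst_fresh: "x \<notin> fv A \<Longrightarrow> subst x s A = A"
  by (induction A) (auto simp: subst_t_fresh)

lemma subst_t_Var [simp]: "subst_t x (Var x) t = t"
  by (induction t) auto

lemma subst_Var [simp]: "subst x (Var x) A = A"
  by (induction A) auto

lemma free_for_Var [simp]: "free_for (Var x) x A"
  by (induction A) auto

lemma free_for_fresh: "x \<notin> fv A \<Longrightarrow> free_for s x A"
  by (induction A) auto

lemma free_for_disjoint: "bv A \<inter> fvt s = {} \<Longrightarrow> free_for s x A"
  by (induction A) auto

lemma fvt_subst_t: "fvt (subst_t x s t) \<subseteq> (fvt t - {x}) \<union> fvt s"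
  by (induction t) auto

lemma fv_subst: "fv (subst x s A) \<subseteq> (fv A - {x}) \<union> fvt s"
  by (induction A) (use fvt_subst_t in \<open>fastforce split: if_splits\<close>)+

lemma bv_subst [simp]: "bv (subst x s A) = bv A"
  by (induction A) auto

lemma subst_t_back: "w \<notin> fvt t \<Longrightarrow> subst_t w (Var x) (subst_t x (Var w) t) = t"
  by (induction t) auto

lemma subst_back:
  "w \<notin> fv A \<Longrightarrow> free_for (Var w) x A \<Longrightarrow> subst w (Var x) (subst x (Var w) A) = A"
  by (induction A) (auto simp: subst_t_back subst_fresh)

lemma free_for_back:
  "w \<notin> fv A \<Longrightarrow> free_for (Var w) x A \<Longrightarrow> free_for (Var x) w (subst x (Var w) A)"
  by (induction A) (auto simp: subst_fresh free_for_fresh)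

lemma free_for_subst:
  "free_for s x A \<Longrightarrow> x \<notin> fvt t \<Longrightarrow> free_for s x (subst y t A)"
  by (induction A) (use fv_subst in fastforce)+

lemma proves_wff: "\<Gamma> \<turnstile> A \<Longrightarrow> wff A"
  by (induction rule: proves.induct) auto


section \<open>Hilbert-style reasoning over a set of sentences\<close>

text \<open>Weakening is not admissible for \<^const>\<open>proves\<close>: bound variables are never renamed, and
  a free variable of an added assumption blocks \<open>AllI\<close>.  Hence all assumptions with free variables
  are kept on the left of an implication that is derived from a fixed set of sentences.\<close>

locale sentences =
  fixes \<Gamma> :: "fm set"
  assumes closed: "A \<in> \<Gamma> \<Longrightarrow> fv A = {}"
begin

text \<open>S and K do the work of a deduction theorem: through \<open>imp_lift\<close> and
  \<open>imp_mp\<close>, modus ponens is applied underneath a hypothesis without adding it to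
  \<Gamma>.\<close>

lemma taut_S:
  assumes "wff C" "wff A" "wff B"
  shows "\<Gamma> \<turnstile> (C \<^bold>\<longrightarrow> A \<^bold>\<longrightarrow> B) \<^bold>\<longrightarrow> (C \<^bold>\<longrightarrow> A) \<^bold>\<longrightarrow> C \<^bold>\<longrightarrow> B"
  using assms
  by (intro ImpI; simp?) (rule ImpE[of _ A], rule ImpE[of _ C], (rule Assm; simp), (rule Assm; simp),
      rule ImpE[of _ C]; rule Assm; simp)

lemma taut_K: "wff A \<Longrightarrow> wff B \<Longrightarrow> \<Gamma> \<turnstile> A \<^bold>\<longrightarrow> B \<^bold>\<longrightarrow> A"
  by (intro ImpI Assm) auto

lemma taut_I: "wff A \<Longrightarrow> \<Gamma> \<turnstile> A \<^bold>\<longrightarrow> A"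
  by (intro ImpI Assm) auto

lemma imp_lift: "\<Gamma> \<turnstile> A \<Longrightarrow> wff C \<Longrightarrow> \<Gamma> \<turnstile> C \<^bold>\<longrightarrow> A"
  using ImpE[OF taut_K] proves_wff by simp

lemma imp_mp: "\<Gamma> \<turnstile> C \<^bold>\<longrightarrow> A \<^bold>\<longrightarrow> B \<Longrightarrow> \<Gamma> \<turnstile> C \<^bold>\<longrightarrow> A \<Longrightarrow> \<Gamma> \<turnstile> C \<^bold>\<longrightarrow> B"
  using taut_S[of C A B, THEN ImpE, THEN ImpE] proves_wff[of \<Gamma> "C \<^bold>\<longrightarrow> A \<^bold>\<longrightarrow> B"] by simp

lemma imp_trans: "\<Gamma> \<turnstile> A \<^bold>\<longrightarrow> B \<Longrightarrow> \<Gamma> \<turnstile> B \<^bold>\<longrightarrow> C \<Longrightarrow> \<Gamma> \<turnstile> A \<^bold>\<longrightarrow> C"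
  using imp_mp[OF imp_lift] proves_wff[of \<Gamma> "A \<^bold>\<longrightarrow> B"] by simp

lemma taut_AndI: "wff A \<Longrightarrow> wff B \<Longrightarrow> \<Gamma> \<turnstile> A \<^bold>\<longrightarrow> B \<^bold>\<longrightarrow> A \<^bold>\<and> B"
  by (intro ImpI AndI Assm) auto

lemma taut_AndE1: "wff A \<Longrightarrow> wff B \<Longrightarrow> \<Gamma> \<turnstile> A \<^bold>\<and> B \<^bold>\<longrightarrow> A"
  by (intro ImpI AndE1[of _ A B] Assm) auto

lemma taut_AndE2: "wff A \<Longrightarrow> wff B \<Longrightarrow> \<Gamma> \<turnstile> A \<^bold>\<and> B \<^bold>\<longrightarrow> B"
  by (intro ImpI AndE2[of _ A B] Assm) auto

lemma taut_OrI1: "wff A \<Longrightarrow> wff B \<Longrightarrow> \<Gamma> \<turnstile> A \<^bold>\<longrightarrow> A \<^bold>\<or> B"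
  by (intro ImpI OrI1 Assm) auto

lemma taut_OrI2: "wff A \<Longrightarrow> wff B \<Longrightarrow> \<Gamma> \<turnstile> B \<^bold>\<longrightarrow> A \<^bold>\<or> B"
  by (intro ImpI OrI2 Assm) auto

lemma taut_OrE:
  assumes "wff A" "wff B" "wff C"
  shows "\<Gamma> \<turnstile> (A \<^bold>\<longrightarrow> C) \<^bold>\<longrightarrow> (B \<^bold>\<longrightarrow> C) \<^bold>\<longrightarrow> A \<^bold>\<or> B \<^bold>\<longrightarrow> C"
  using assms
  by (intro ImpI; simp?) (rule OrE[of _ A B], (rule Assm; simp), rule ImpE[of _ A],
      (rule Assm; simp), (rule Assm; simp), rule ImpE[of _ B]; rule Assm; simp)

lemma taut_DN: "wff A \<Longrightarrow> \<Gamma> \<turnstile> \<^bold>\<not> \<^bold>\<not> A \<^bold>\<longrightarrow> A"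
  by (rule ImpI, simp, rule Classical, assumption)
    (rule ImpE[of _ "\<^bold>\<not> A"]; rule Assm; simp)

lemma taut_NegE: "wff A \<Longrightarrow> wff B \<Longrightarrow> \<Gamma> \<turnstile> \<^bold>\<not> A \<^bold>\<longrightarrow> A \<^bold>\<longrightarrow> B"
  by (rule ImpI, simp, rule ImpI, assumption, rule Classical, assumption)
    (rule ImpE[of _ A]; rule Assm; simp)

lemma imp_curry:
  assumes "\<Gamma> \<turnstile> A \<^bold>\<and> B \<^bold>\<longrightarrow> C" shows "\<Gamma> \<turnstile> A \<^bold>\<longrightarrow> B \<^bold>\<longrightarrow> C"
proof -
  have wf: "wff A" "wff B" "wff C" using proves_wff[OF assms] by auto
  have "\<Gamma> \<turnstile> (A \<^bold>\<and> B \<^bold>\<longrightarrow> C) \<^bold>\<longrightarrow> A \<^bold>\<longrightarrow> B \<^bold>\<longrightarrow> C"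
    using wf by (intro ImpI; simp?) (rule ImpE[of _ "A \<^bold>\<and> B"], (rule Assm; simp), rule AndI; rule Assm; simp)
  then show ?thesis using assms ImpE by blast
qed

lemma imp_swap:
  assumes "\<Gamma> \<turnstile> A \<^bold>\<longrightarrow> B \<^bold>\<longrightarrow> C" shows "\<Gamma> \<turnstile> B \<^bold>\<longrightarrow> A \<^bold>\<longrightarrow> C"
proof -
  have wf: "wff A" "wff B" "wff C" using proves_wff[OF assms] by auto
  have "\<Gamma> \<turnstile> (A \<^bold>\<longrightarrow> B \<^bold>\<longrightarrow> C) \<^bold>\<longrightarrow> B \<^bold>\<longrightarrow> A \<^bold>\<longrightarrow> C"
    using wf by (intro ImpI; simp?) (rule ImpE[of _ B], rule ImpE[of _ A]; rule Assm; simp)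
  then show ?thesis using assms ImpE by blast
qed

lemma imp_contract:
  assumes "\<Gamma> \<turnstile> A \<^bold>\<longrightarrow> A \<^bold>\<longrightarrow> C" shows "\<Gamma> \<turnstile> A \<^bold>\<longrightarrow> C"
  using imp_mp[OF assms taut_I] proves_wff[OF assms] by simp

lemma imp_cong:
  assumes "\<Gamma> \<turnstile> A' \<^bold>\<longrightarrow> A" "\<Gamma> \<turnstile> B \<^bold>\<longrightarrow> B'"
  shows "\<Gamma> \<turnstile> (A \<^bold>\<longrightarrow> B) \<^bold>\<longrightarrow> A' \<^bold>\<longrightarrow> B'"
proof -
  have wf: "wff A" "wff B" "wff A'" "wff B'" using assms[THEN proves_wff] by auto
  have "\<Gamma> \<turnstile> (A' \<^bold>\<longrightarrow> A) \<^bold>\<longrightarrow> (B \<^bold>\<longrightarrow> B') \<^bold>\<longrightarrow> (A \<^bold>\<longrightarrow> B) \<^bold>\<longrightarrow> A' \<^bold>\<longrightarrow> B'"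
    using wf by (intro ImpI; simp?) (rule ImpE[of _ B], (rule Assm; simp), rule ImpE[of _ A], (rule Assm; simp),
      rule ImpE[of _ A']; rule Assm; simp)
  then show ?thesis using assms ImpE by blast
qed

lemma and_cong:
  assumes "\<Gamma> \<turnstile> A \<^bold>\<longrightarrow> A'" "\<Gamma> \<turnstile> B \<^bold>\<longrightarrow> B'"
  shows "\<Gamma> \<turnstile> A \<^bold>\<and> B \<^bold>\<longrightarrow> A' \<^bold>\<and> B'"
proof -
  have wf: "wff A" "wff B" "wff A'" "wff B'" using assms[THEN proves_wff] by auto
  have 1: "\<Gamma> \<turnstile> A \<^bold>\<and> B \<^bold>\<longrightarrow> A'" and 2: "\<Gamma> \<turnstile> A \<^bold>\<and> B \<^bold>\<longrightarrow> B'"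
    using imp_trans[OF taut_AndE1 assms(1)] imp_trans[OF taut_AndE2 assms(2)] wf by auto
  show ?thesis
    using imp_mp[OF imp_trans[OF 1 taut_AndI] 2] wf by blast
qed

lemma or_cong:
  assumes "\<Gamma> \<turnstile> A \<^bold>\<longrightarrow> A'" "\<Gamma> \<turnstile> B \<^bold>\<longrightarrow> B'"
  shows "\<Gamma> \<turnstile> A \<^bold>\<or> B \<^bold>\<longrightarrow> A' \<^bold>\<or> B'"
proof -
  have wf: "wff A" "wff B" "wff A'" "wff B'" using assms[THEN proves_wff] by auto
  have "\<Gamma> \<turnstile> A \<^bold>\<longrightarrow> A' \<^bold>\<or> B'" "\<Gamma> \<turnstile> B \<^bold>\<longrightarrow> A' \<^bold>\<or> B'"
    using imp_trans[OF assms(1) taut_OrI1] imp_trans[OF assms(2) taut_OrI2] wf by auto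
  then show ?thesis using taut_OrE[of A B "A' \<^bold>\<or> B'", THEN ImpE, THEN ImpE] wf by simp
qed

lemma gen: "\<Gamma> \<turnstile> A \<Longrightarrow> \<Gamma> \<turnstile> \<^bold>\<forall>x. A"
  using AllI closed by simp

lemma all_inst:
  "wff A \<Longrightarrow> t \<Colon> snd x \<Longrightarrow> free_for t x A \<Longrightarrow> \<Gamma> \<turnstile> (\<^bold>\<forall>x. A) \<^bold>\<longrightarrow> subst x t A"
  by (intro ImpI AllE Assm) auto

lemma ex_inst:
  "wff A \<Longrightarrow> t \<Colon> snd x \<Longrightarrow> free_for t x A \<Longrightarrow> \<Gamma> \<turnstile> subst x t A \<^bold>\<longrightarrow> (\<^bold>\<exists>x. A)"
  by (intro ImpI ExI[of _ x t] Assm) auto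

text \<open>For want of weakening, the given derivation cannot be repeated with B assumed. The
  generalised implication is therefore assumed as well: x is free neither in it nor in B, so
  \<open>AllI\<close> stays applicable, and \<open>gen\<close> discharges it at the end. The proof
  of \<open>ex_elim\<close> uses the same device.\<close>

lemma all_intro:
  assumes "\<Gamma> \<turnstile> B \<^bold>\<longrightarrow> A" "x \<notin> fv B" shows "\<Gamma> \<turnstile> B \<^bold>\<longrightarrow> (\<^bold>\<forall>x. A)"
proof -
  have wf: "wff A" "wff B" using proves_wff[OF assms(1)] by auto
  let ?G = "insert B (insert (\<^bold>\<forall>x. (B \<^bold>\<longrightarrow> A)) \<Gamma>)"
  have "?G \<turnstile> \<^bold>\<forall>x. (B \<^bold>\<longrightarrow> A)" using wf by (intro Assm) auto
  from AllE[OF this, of "Var x"] have "?G \<turnstile> B \<^bold>\<longrightarrow> A" by simp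
  moreover have "?G \<turnstile> B" using wf by (intro Assm) auto
  ultimately have "?G \<turnstile> \<^bold>\<forall>x. A" using assms(2) closed by (intro AllI ImpE[of _ B A]) auto
  then have "\<Gamma> \<turnstile> (\<^bold>\<forall>x. (B \<^bold>\<longrightarrow> A)) \<^bold>\<longrightarrow> B \<^bold>\<longrightarrow> (\<^bold>\<forall>x. A)" using wf by (intro ImpI) auto
  then show ?thesis using gen[OF assms(1)] ImpE by blast
qed

lemma ex_elim:
  assumes "\<Gamma> \<turnstile> A \<^bold>\<longrightarrow> B" "x \<notin> fv B" shows "\<Gamma> \<turnstile> (\<^bold>\<exists>x. A) \<^bold>\<longrightarrow> B"
proof -
  have wf: "wff A" "wff B" using proves_wff[OF assms(1)] by auto
  let ?G = "insert (\<^bold>\<exists>x. A) (insert (\<^bold>\<forall>x. (A \<^bold>\<longrightarrow> B)) \<Gamma>)"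
  have "insert A ?G \<turnstile> \<^bold>\<forall>x. (A \<^bold>\<longrightarrow> B)" using wf by (intro Assm) auto
  from AllE[OF this, of "Var x"] have "insert A ?G \<turnstile> A \<^bold>\<longrightarrow> B" by simp
  moreover have "insert A ?G \<turnstile> A" using wf by (intro Assm) auto
  ultimately have "insert A ?G \<turnstile> B" by (rule ImpE)
  moreover have "?G \<turnstile> \<^bold>\<exists>x. A" using wf by (intro Assm) auto
  ultimately have "?G \<turnstile> B" using assms(2) closed by (intro ExE[of ?G x A B]) auto
  then have "\<Gamma> \<turnstile> (\<^bold>\<forall>x. (A \<^bold>\<longrightarrow> B)) \<^bold>\<longrightarrow> (\<^bold>\<exists>x. A) \<^bold>\<longrightarrow> B" using wf by (intro ImpI) auto
  then show ?thesis using gen[OF assms(1)] ImpE by blast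
qed

text \<open>Draws the universal clause of the truth lemma from the existential one, so that
  witnesses have to be supplied for existential formulas only.\<close>

lemma not_ex_not:
  assumes "wff A" shows "\<Gamma> \<turnstile> \<^bold>\<not> (\<^bold>\<exists>x. \<^bold>\<not> A) \<^bold>\<longrightarrow> (\<^bold>\<forall>x. A)"
proof -
  have "\<Gamma> \<turnstile> \<^bold>\<not> A \<^bold>\<longrightarrow> (\<^bold>\<exists>x. \<^bold>\<not> A)" using ex_inst[of "\<^bold>\<not> A" "Var x" x] assms by simp
  then have "\<Gamma> \<turnstile> \<^bold>\<not> (\<^bold>\<exists>x. \<^bold>\<not> A) \<^bold>\<longrightarrow> \<^bold>\<not> \<^bold>\<not> A"
    by (rule imp_swap[OF imp_trans]) (use assms in \<open>simp add: imp_swap[OF taut_I]\<close>)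
  then show ?thesis using all_intro[OF imp_trans[OF _ taut_DN]] assms by simp
qed

lemma all_cong: "\<Gamma> \<turnstile> A \<^bold>\<longrightarrow> B \<Longrightarrow> \<Gamma> \<turnstile> (\<^bold>\<forall>x. A) \<^bold>\<longrightarrow> (\<^bold>\<forall>x. B)"
  using all_intro[OF imp_trans[OF all_inst[of A "Var x" x]]] proves_wff[of \<Gamma> "A \<^bold>\<longrightarrow> B"] by simp

lemma ex_cong: "\<Gamma> \<turnstile> A \<^bold>\<longrightarrow> B \<Longrightarrow> \<Gamma> \<turnstile> (\<^bold>\<exists>x. A) \<^bold>\<longrightarrow> (\<^bold>\<exists>x. B)"
  using ex_elim[OF imp_trans[OF _ ex_inst[of B "Var x" x, simplified]]] proves_wff[of \<Gamma> "A \<^bold>\<longrightarrow> B"] by simp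

end


section \<open>Renaming of bound variables\<close>

text \<open>Doubling makes every new bound index even, as \<open>admissible\<close> demands; adding
  m lifts it above all indices smaller than m, so it clashes with no variable of a formula bounded
  by m.\<close>

definition shift :: "nat \<Rightarrow> var \<Rightarrow> var" where
  "shift m v = (2 * (fst v + m), snd v)"

primrec ren :: "nat \<Rightarrow> fm \<Rightarrow> fm" where
  "ren m (s \<^bold>= t) = (s \<^bold>= t)"
| "ren m (St t) = St t"
| "ren m \<^bold>\<bottom> = \<^bold>\<bottom>"
| "ren m (A \<^bold>\<longrightarrow> B) = (ren m A \<^bold>\<longrightarrow> ren m B)"
| "ren m (A \<^bold>\<and> B) = (ren m A \<^bold>\<and> ren m B)"
| "ren m (A \<^bold>\<or> B) = (ren m A \<^bold>\<or> ren m B)"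
| "ren m (\<^bold>\<forall>x. A) = (\<^bold>\<forall>(shift m x). subst x (Var (shift m x)) (ren m A))"
| "ren m (\<^bold>\<exists>x. A) = (\<^bold>\<exists>(shift m x). subst x (Var (shift m x)) (ren m A))"

lemma snd_shift [simp]: "snd (shift m x) = snd x"
  by (simp add: shift_def)

lemma shift_eq_iff [simp]: "shift m x = shift m y \<longleftrightarrow> x = y"
  by (auto simp: shift_def prod_eq_iff)

lemma shift_neq: "fst x < m \<Longrightarrow> shift m y \<noteq> x"
  unfolding shift_def by (cases x) auto

lemma wff_ren [simp]: "wff (ren m A) = wff A"
  by (induction A) auto

lemma bv_ren: "bv (ren m A) = shift m ` bv A"
  by (induction A) auto

lemma fv_ren: "fv (ren m A) \<subseteq> fv A"
  by (induction A) (use fv_subst in fastforce)+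

text \<open>An inner binder \<open>shift m y\<close> could capture \<open>shift m x\<close> only if
  y = x, and then x is no longer free in that subformula.\<close>

lemma free_for_ren: "fst x < m \<Longrightarrow> free_for (Var (shift m x)) x (ren m A)"
proof (induction A)
  case (All y A)
  have "x \<noteq> shift m y" using shift_neq[of x m y] All.prems by auto
  then show ?case
    using All fv_subst[of y "Var (shift m y)" "ren m A"]
      free_for_subst[of "Var (shift m x)" x "ren m A" "Var (shift m y)" y] by auto
next
  case (Ex y A)
  have "x \<noteq> shift m y" using shift_neq[of x m y] Ex.prems by auto
  then show ?case
    using Ex fv_subst[of y "Var (shift m y)" "ren m A"]
      free_for_subst[of "Var (shift m x)" x "ren m A" "Var (shift m y)" y] by auto
qed auto

context sentences
begin

lemma alpha_equiv:
  assumes "wff A" "w \<notin> fv A" "snd w = snd x" "free_for (Var w) x A"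
  shows "\<Gamma> \<turnstile> (\<^bold>\<forall>x. A) \<^bold>\<longrightarrow> (\<^bold>\<forall>w. subst x (Var w) A)"
    and "\<Gamma> \<turnstile> (\<^bold>\<forall>w. subst x (Var w) A) \<^bold>\<longrightarrow> (\<^bold>\<forall>x. A)"
    and "\<Gamma> \<turnstile> (\<^bold>\<exists>x. A) \<^bold>\<longrightarrow> (\<^bold>\<exists>w. subst x (Var w) A)"
    and "\<Gamma> \<turnstile> (\<^bold>\<exists>w. subst x (Var w) A) \<^bold>\<longrightarrow> (\<^bold>\<exists>x. A)"
proof -
  let ?B = "subst x (Var w) A"
  have bk: "subst w (Var x) ?B = A" "free_for (Var x) w ?B" and wf: "wff ?B"
    using assms subst_back free_for_back by auto
  have fr: "x \<notin> fv (\<^bold>\<forall>w. ?B)" "x \<notin> fv (\<^bold>\<exists>w. ?B)"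
    using fv_subst[of x "Var w" A] by auto
  show "\<Gamma> \<turnstile> (\<^bold>\<forall>x. A) \<^bold>\<longrightarrow> (\<^bold>\<forall>w. ?B)"
    using assms by (intro all_intro all_inst) auto
  show "\<Gamma> \<turnstile> (\<^bold>\<forall>w. ?B) \<^bold>\<longrightarrow> (\<^bold>\<forall>x. A)"
    using all_inst[of ?B "Var x" w] bk wf assms(3) fr(1) by (intro all_intro) auto
  show "\<Gamma> \<turnstile> (\<^bold>\<exists>x. A) \<^bold>\<longrightarrow> (\<^bold>\<exists>w. ?B)"
    using ex_inst[of ?B "Var x" w] bk wf assms(3) fr(2) by (intro ex_elim) auto
  show "\<Gamma> \<turnstile> (\<^bold>\<exists>w. ?B) \<^bold>\<longrightarrow> (\<^bold>\<exists>x. A)"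
    using assms by (intro ex_elim ex_inst) auto
qed

lemma ren_equiv:
  assumes "wff A" "\<And>v. v \<in> fv A \<union> bv A \<Longrightarrow> fst v < m"
  shows "(\<Gamma> \<turnstile> A \<^bold>\<longrightarrow> ren m A) \<and> (\<Gamma> \<turnstile> ren m A \<^bold>\<longrightarrow> A)"
  using assms
proof (induction A)
  case (All x A)
  have bd: "fst v < m" if "v \<in> fv A \<union> bv A" for v
    using All.prems(2)[of v] All.prems(2)[of x] that by auto
  then have IH: "\<Gamma> \<turnstile> A \<^bold>\<longrightarrow> ren m A" "\<Gamma> \<turnstile> ren m A \<^bold>\<longrightarrow> A" using All by auto
  have "shift m x \<notin> fv (ren m A)"
    using fv_ren[of m A] bd[of "shift m x"] shift_neq by blast
  moreover have "free_for (Var (shift m x)) x (ren m A)" using All.prems(2) free_for_ren by simp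
  ultimately show ?case
    using imp_trans[OF all_cong[OF IH(1), of x] alpha_equiv(1)[of "ren m A" "shift m x" x]]
      imp_trans[OF alpha_equiv(2)[of "ren m A" "shift m x" x] all_cong[OF IH(2), of x]]
      All.prems(1) by simp
next
  case (Ex x A)
  have bd: "fst v < m" if "v \<in> fv A \<union> bv A" for v
    using Ex.prems(2)[of v] Ex.prems(2)[of x] that by auto
  then have IH: "\<Gamma> \<turnstile> A \<^bold>\<longrightarrow> ren m A" "\<Gamma> \<turnstile> ren m A \<^bold>\<longrightarrow> A" using Ex by auto
  have "shift m x \<notin> fv (ren m A)"
    using fv_ren[of m A] bd[of "shift m x"] shift_neq by blast
  moreover have "free_for (Var (shift m x)) x (ren m A)" using Ex.prems(2) free_for_ren by simp
  ultimately show ?case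
    using imp_trans[OF ex_cong[OF IH(1), of x] alpha_equiv(3)[of "ren m A" "shift m x" x]]
      imp_trans[OF alpha_equiv(4)[of "ren m A" "shift m x" x] ex_cong[OF IH(2), of x]]
      Ex.prems(1) by simp
qed (auto intro: taut_I imp_cong and_cong or_cong)

end


section \<open>Structures\<close>

text \<open>\<open>eq0\<close> is a relation rather than identity because distinct elements of the
  term model may be provably equal. All types share one carrier, and their domains may
  overlap.\<close>

record 'a struc =
  dom :: "ty \<Rightarrow> 'a set"
  app :: "'a \<Rightarrow> 'a \<Rightarrow> 'a"
  con :: "const \<Rightarrow> 'a"
  eq0 :: "'a \<Rightarrow> 'a \<Rightarrow> bool"
  std :: "'a \<Rightarrow> bool"

primrec val :: "'a struc \<Rightarrow> (var \<Rightarrow> 'a) \<Rightarrow> trm \<Rightarrow> 'a" where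
  "val M e (Var v) = e v"
| "val M e (Con c) = con M c"
| "val M e (t \<cdot> u) = app M (val M e t) (val M e u)"

primrec sat :: "'a struc \<Rightarrow> fm \<Rightarrow> (var \<Rightarrow> 'a) \<Rightarrow> bool" where
  "sat M (s \<^bold>= t) e = eq0 M (val M e s) (val M e t)"
| "sat M (St t) e = std M (val M e t)"
| "sat M \<^bold>\<bottom> e = False"
| "sat M (A \<^bold>\<longrightarrow> B) e = (sat M A e \<longrightarrow> sat M B e)"
| "sat M (A \<^bold>\<and> B) e = (sat M A e \<and> sat M B e)"
| "sat M (A \<^bold>\<or> B) e = (sat M A e \<or> sat M B e)"
| "sat M (\<^bold>\<forall>x. A) e = (\<forall>a \<in> dom M (snd x). sat M A (e(x := a)))"
| "sat M (\<^bold>\<exists>x. A) e = (\<exists>a \<in> dom M (snd x). sat M A (e(x := a)))"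

definition env :: "'a struc \<Rightarrow> (var \<Rightarrow> 'a) \<Rightarrow> bool" where
  "env M e \<longleftrightarrow> (\<forall>v. e v \<in> dom M (snd v))"

definition struct :: "'a struc \<Rightarrow> bool" where
  "struct M \<longleftrightarrow> (\<forall>c. con M c \<in> dom M (ctype c)) \<and>
     (\<forall>\<sigma> \<tau>. \<forall>f \<in> dom M (\<sigma> \<leadsto> \<tau>). \<forall>a \<in> dom M \<sigma>. app M f a \<in> dom M \<tau>)"

lemma tyof_App_iff [simp]:
  "t \<cdot> u \<Colon> \<tau> \<longleftrightarrow> (\<exists>\<sigma>. t \<Colon> \<sigma> \<leadsto> \<tau> \<and> u \<Colon> \<sigma>)"
  by (auto split: option.splits ty.splits)

declare tyof.simps(3) [simp del]

lemma env_upd [simp]: "env M e \<Longrightarrow> a \<in> dom M (snd x) \<Longrightarrow> env M (e(x := a))"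
  by (auto simp: env_def)

lemma val_in_dom: "struct M \<Longrightarrow> env M e \<Longrightarrow> t \<Colon> \<sigma> \<Longrightarrow> val M e t \<in> dom M \<sigma>"
  by (induction t arbitrary: \<sigma>) (auto simp: struct_def env_def)

lemma val_cong: "(\<And>v. v \<in> fvt t \<Longrightarrow> e v = e' v) \<Longrightarrow> val M e t = val M e' t"
  by (induction t) auto

lemma val_upd [simp]: "x \<notin> fvt t \<Longrightarrow> val M (e(x := a)) t = val M e t"
  by (rule val_cong) auto

lemma sat_cong: "(\<And>v. v \<in> fv A \<Longrightarrow> e v = e' v) \<Longrightarrow> sat M A e = sat M A e'"
proof (induction A arbitrary: e e')
  case (Eq s t)
  then show ?case using val_cong[of s e e' M] val_cong[of t e e' M] by simp
next
  case (St t)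
  then show ?case using val_cong[of t e e' M] by simp
next
  case (All x A)
  have "sat M A (e(x := a)) = sat M A (e'(x := a))" for a
    by (rule All.IH) (use All.prems in auto)
  then show ?case by simp
next
  case (Ex x A)
  have "sat M A (e(x := a)) = sat M A (e'(x := a))" for a
    by (rule Ex.IH) (use Ex.prems in auto)
  then show ?case by simp
next
  case (Imp A B)
  have "sat M A e = sat M A e'" by (rule Imp.IH(1)) (use Imp.prems in auto)
  moreover have "sat M B e = sat M B e'" by (rule Imp.IH(2)) (use Imp.prems in auto)
  ultimately show ?case by simp
next
  case (And A B)
  have "sat M A e = sat M A e'" by (rule And.IH(1)) (use And.prems in auto)
  moreover have "sat M B e = sat M B e'" by (rule And.IH(2)) (use And.prems in auto)
  ultimately show ?case by simp
next
  case (Or A B)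
  have "sat M A e = sat M A e'" by (rule Or.IH(1)) (use Or.prems in auto)
  moreover have "sat M B e = sat M B e'" by (rule Or.IH(2)) (use Or.prems in auto)
  ultimately show ?case by simp
qed simp

lemma sat_upd [simp]: "x \<notin> fv A \<Longrightarrow> sat M A (e(x := a)) = sat M A e"
  by (rule sat_cong) auto

lemma val_subst_t: "val M e (subst_t x s t) = val M (e(x := val M e s)) t"
  by (induction t) auto

lemma sat_subst:
  "free_for s x A \<Longrightarrow> sat M (subst x s A) e = sat M A (e(x := val M e s))"
proof (induction A arbitrary: e)
  case (All y A)
  show "sat M (subst x s (\<^bold>\<forall>y. A)) e = sat M (\<^bold>\<forall>y. A) (e(x := val M e s))"
  proof (cases "x \<in> fv (\<^bold>\<forall>y. A)")
    case True
    then have "y \<noteq> x" "y \<notin> fvt s" "free_for s x A" using All.prems by auto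
    moreover from this have "e(y := a, x := b) = e(x := b, y := a)" for a b
      by (intro fun_upd_twist)
    moreover have "sat M (subst x s A) e' = sat M A (e'(x := val M e' s))" for e'
      by (rule All.IH) fact
    ultimately show ?thesis by simp
  next
    case False
    then show ?thesis by (metis sat_upd subst_fresh)
  qed
next
  case (Ex y A)
  show "sat M (subst x s (\<^bold>\<exists>y. A)) e = sat M (\<^bold>\<exists>y. A) (e(x := val M e s))"
  proof (cases "x \<in> fv (\<^bold>\<exists>y. A)")
    case True
    then have "y \<noteq> x" "y \<notin> fvt s" "free_for s x A" using Ex.prems by auto
    moreover from this have "e(y := a, x := b) = e(x := b, y := a)" for a b
      by (intro fun_upd_twist)
    moreover have "sat M (subst x s A) e' = sat M A (e'(x := val M e' s))" for e'
      by (rule Ex.IH) fact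
    ultimately show ?thesis by simp
  next
    case False
    then show ?thesis by (metis sat_upd subst_fresh)
  qed
qed (auto simp: val_subst_t)

lemma sat_ren:
  assumes "\<And>v. v \<in> fv A \<union> bv A \<Longrightarrow> fst v < m"
  shows "sat M (ren m A) e = sat M A e"
  using assms
proof (induction A arbitrary: e)
  case (All x A)
  have bd: "fst v < m" if "v \<in> fv A \<union> bv A" for v
    using All.prems[of v] All.prems[of x] that by auto
  have "x \<noteq> shift m x" using shift_neq[of x m x] All.prems[of x] by auto
  moreover have "shift m x \<notin> fv A" using bd[of "shift m x"] shift_neq by blast
  moreover from calculation have "e(shift m x := a, x := a) = e(x := a, shift m x := a)" for a
    by (intro fun_upd_twist) auto
  ultimately show ?case
    using All.IH bd All.prems[of x] by (simp add: sat_subst free_for_ren)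
next
  case (Ex x A)
  have bd: "fst v < m" if "v \<in> fv A \<union> bv A" for v
    using Ex.prems[of v] Ex.prems[of x] that by auto
  have "x \<noteq> shift m x" using shift_neq[of x m x] Ex.prems[of x] by auto
  moreover have "shift m x \<notin> fv A" using bd[of "shift m x"] shift_neq by blast
  moreover from calculation have "e(shift m x := a, x := a) = e(x := a, shift m x := a)" for a
    by (intro fun_upd_twist) auto
  ultimately show ?case
    using Ex.IH bd Ex.prems[of x] by (simp add: sat_subst free_for_ren)
qed auto


section \<open>Completeness\<close>

definition odd_vars :: "var set" where "odd_vars = {v. odd (fst v)}"

text \<open>Bound variables have even and free variables odd indices, so that substituting an
  odd term never captures a variable.\<close>

definition admissible :: "fm \<Rightarrow> bool" where
  "admissible A \<longleftrightarrow> wff A \<and> bv A \<inter> odd_vars = {} \<and> fv A \<subseteq> odd_vars"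

primrec psubst_t :: "(var \<Rightarrow> trm) \<Rightarrow> trm \<Rightarrow> trm" where
  "psubst_t e (Var v) = e v"
| "psubst_t e (Con c) = Con c"
| "psubst_t e (t \<cdot> u) = psubst_t e t \<cdot> psubst_t e u"

primrec psubst :: "fm \<Rightarrow> (var \<Rightarrow> trm) \<Rightarrow> fm" where
  "psubst (s \<^bold>= t) e = (psubst_t e s \<^bold>= psubst_t e t)"
| "psubst (St t) e = St (psubst_t e t)"
| "psubst \<^bold>\<bottom> e = \<^bold>\<bottom>"
| "psubst (A \<^bold>\<longrightarrow> B) e = (psubst A e \<^bold>\<longrightarrow> psubst B e)"
| "psubst (A \<^bold>\<and> B) e = (psubst A e \<^bold>\<and> psubst B e)"
| "psubst (A \<^bold>\<or> B) e = (psubst A e \<^bold>\<or> psubst B e)"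
| "psubst (\<^bold>\<forall>x. A) e = (\<^bold>\<forall>x. psubst A (e(x := Var x)))"
| "psubst (\<^bold>\<exists>x. A) e = (\<^bold>\<exists>x. psubst A (e(x := Var x)))"

lemma psubst_t_id: "(\<And>v. v \<in> fvt t \<Longrightarrow> e v = Var v) \<Longrightarrow> psubst_t e t = t"
  by (induction t) auto

lemma psubst_id: "(\<And>v. v \<in> fv A \<Longrightarrow> e v = Var v) \<Longrightarrow> psubst A e = A"
  by (induction A arbitrary: e) (auto simp: psubst_t_id)

lemma tyof_psubst_t: "(\<And>v. e v \<Colon> snd v) \<Longrightarrow> tyof (psubst_t e t) = tyof t"
  by (induction t) (auto simp: tyof.simps(3) split: option.splits ty.splits)

lemma wff_psubst: "(\<And>v. e v \<Colon> snd v) \<Longrightarrow> wff (psubst A e) = wff A"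
  by (induction A arbitrary: e) (auto simp: tyof_psubst_t)

lemma bv_psubst [simp]: "bv (psubst A e) = bv A"
  by (induction A arbitrary: e) auto

lemma fvt_psubst_t: "fvt (psubst_t e t) = (\<Union>v \<in> fvt t. fvt (e v))"
  by (induction t) auto

lemma fv_psubst: "fv (psubst A e) \<subseteq> (\<Union>v \<in> fv A. fvt (e v))"
proof (induction A arbitrary: e)
  case (All x A)
  have "(\<Union>v \<in> fv A. fvt ((e(x := Var x)) v)) \<subseteq> insert x (\<Union>v \<in> fv A - {x}. fvt (e v))"
    by (auto split: if_splits)
  with All.IH[of "e(x := Var x)"] show ?case
    by (simp only: psubst.simps fv.simps Diff_subset_conv Un_insert_left Un_empty_left)
next
  case (Ex x A)
  have "(\<Union>v \<in> fv A. fvt ((e(x := Var x)) v)) \<subseteq> insert x (\<Union>v \<in> fv A - {x}. fvt (e v))"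
    by (auto split: if_splits)
  with Ex.IH[of "e(x := Var x)"] show ?case
    by (simp only: psubst.simps fv.simps Diff_subset_conv Un_insert_left Un_empty_left)
next
  case (Imp A B)
  show ?case using Imp.IH[of e] by auto
next
  case (And A B)
  show ?case using And.IH[of e] by auto
next
  case (Or A B)
  show ?case using Or.IH[of e] by auto
qed (auto simp: fvt_psubst_t)

lemma subst_t_psubst_t:
  "(\<And>v. v \<noteq> x \<Longrightarrow> x \<notin> fvt (e v)) \<Longrightarrow>
   subst_t x s (psubst_t (e(x := Var x)) t) = psubst_t (e(x := s)) t"
  by (induction t) (auto simp: subst_t_fresh)

text \<open>Equates an instance of a quantified formula with the value of its body in the updated
  environment; the quantifier cases of \<open>sat_term_model\<close> compare exactly these
  two.\<close>

lemma subst_psubst: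
  "(\<And>v. v \<noteq> x \<Longrightarrow> x \<notin> fvt (e v)) \<Longrightarrow>
   subst x s (psubst A (e(x := Var x))) = psubst A (e(x := s))"
proof (induction A arbitrary: e)
  case (All y A)
  show "subst x s (psubst (\<^bold>\<forall>y. A) (e(x := Var x))) = psubst (\<^bold>\<forall>y. A) (e(x := s))"
  proof (cases "y = x")
    case True
    then show ?thesis by simp
  next
    case False
    then have "e(y := Var y, x := b) = e(x := b, y := Var y)" for b by (intro fun_upd_twist)
    moreover have "subst x s (psubst A (e(y := Var y, x := Var x))) = psubst A (e(y := Var y, x := s))"
      by (rule All.IH) (use All.prems in auto)
    ultimately show ?thesis using False by simp
  qed
next
  case (Ex y A)
  show "subst x s (psubst (\<^bold>\<exists>y. A) (e(x := Var x))) = psubst (\<^bold>\<exists>y. A) (e(x := s))"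
  proof (cases "y = x")
    case True
    then show ?thesis by simp
  next
    case False
    then have "e(y := Var y, x := b) = e(x := b, y := Var y)" for b by (intro fun_upd_twist)
    moreover have "subst x s (psubst A (e(y := Var y, x := Var x))) = psubst A (e(y := Var y, x := s))"
      by (rule Ex.IH) (use Ex.prems in auto)
    ultimately show ?thesis using False by simp
  qed
qed (auto simp: subst_t_psubst_t)

lemma admissible_subst:
  assumes "wff A" "bv A \<inter> odd_vars = {}" "fv A - {x} \<subseteq> odd_vars" "t \<Colon> snd x" "fvt t \<subseteq> odd_vars"
  shows "admissible (subst x t A)" "free_for t x A"
  using assms fv_subst[of x t A] free_for_disjoint[of A t x] by (auto simp: admissible_def)

lemma admissible_psubst:
  assumes "wff A" "bv A \<inter> odd_vars = {}" "\<And>v. e v \<Colon> snd v \<and> fvt (e v) \<subseteq> odd_vars"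
  shows "admissible (psubst A e)"
  unfolding admissible_def using assms fv_psubst[of A e] wff_psubst[of e A] by fastforce

section \<open>Henkin witnesses and the chain of consistent formulas\<close>

definition witness :: "fm \<Rightarrow> var \<Rightarrow> fm \<Rightarrow> var" where
  "witness c x B = (SOME w. w \<in> odd_vars \<and> snd w = snd x \<and> w \<notin> fv c \<union> fv B)"

lemma witness:
  "witness c x B \<in> odd_vars" "snd (witness c x B) = snd x" "witness c x B \<notin> fv c \<union> fv B"
proof -
  let ?F = "fst ` (fv c \<union> fv B)"
  have "finite ?F" by simp
  then obtain n where n: "\<forall>i \<in> ?F. i < n" using finite_nat_set_iff_bounded by blast
  then have "(2 * n + 1, snd x) \<notin> fv c \<union> fv B" by force
  then have "\<exists>w. w \<in> odd_vars \<and> snd w = snd x \<and> w \<notin> fv c \<union> fv B"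
    by (intro exI[of _ "(2 * n + 1, snd x)"]) (simp add: odd_vars_def)
  from someI_ex[OF this] show "witness c x B \<in> odd_vars" "snd (witness c x B) = snd x"
    "witness c x B \<notin> fv c \<union> fv B"
    unfolding witness_def by blast+
qed

definition with_witness :: "fm \<Rightarrow> fm \<Rightarrow> fm" where
  "with_witness c A =
     (case A of (\<^bold>\<exists>x. B) \<Rightarrow> A \<^bold>\<and> subst x (Var (witness c x B)) B | _ \<Rightarrow> A)"

locale henkin = sentences +
  fixes C :: fm
  assumes adm_C: "admissible C" and cons_C: "\<not> (\<Gamma> \<turnstile> \<^bold>\<not> C)"
begin

text \<open>Every stage is one formula: its consistency is the unprovability of its negation from
  \<Gamma>, and an odd variable fresh for it can always be found to act as Henkin constant. Each
  formula gets its turn at the stage given by its code.\<close>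

primrec chain :: "nat \<Rightarrow> fm" where
  "chain 0 = C"
| "chain (Suc n) =
     (if admissible (from_nat n) \<and> \<not> (\<Gamma> \<turnstile> chain n \<^bold>\<longrightarrow> \<^bold>\<not> from_nat n)
      then chain n \<^bold>\<and> with_witness (chain n) (from_nat n) else chain n)"

lemma with_witness_cases:
  obtains x B where "A = (\<^bold>\<exists>x. B)" "with_witness c A = (A \<^bold>\<and> subst x (Var (witness c x B)) B)"
  | "with_witness c A = A"
  by (cases A) (auto simp: with_witness_def)

lemma adm_witness:
  assumes "admissible (\<^bold>\<exists>x. B)" shows "admissible (subst x (Var (witness c x B)) B)"
    "free_for (Var (witness c x B)) x B"
  using assms admissible_subst[of B x "Var (witness c x B)"] witness[of c x B]
  by (auto simp: admissible_def)

lemma adm_with_witness: "admissible A \<Longrightarrow> admissible (with_witness c A)"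
  by (rule with_witness_cases[of A c]) (use adm_witness in \<open>auto simp: admissible_def\<close>)

text \<open>The witness variable is fresh for A and c, so a refutation using the witness instance
  can be generalised over it, renamed back to x and fed to existential elimination. A is kept in
  \<open>?R\<close> because the refutation may use it too; contraction removes the
  duplicate.\<close>

lemma consistent_with_witness:
  assumes adm: "admissible c" "admissible A" and incons: "\<Gamma> \<turnstile> \<^bold>\<not> (c \<^bold>\<and> with_witness c A)"
  shows "\<Gamma> \<turnstile> c \<^bold>\<longrightarrow> \<^bold>\<not> A"
proof (rule with_witness_cases[of A c])
  assume "with_witness c A = A"
  then show ?thesis using imp_curry incons by simp
next
  fix x B assume A: "A = (\<^bold>\<exists>x. B)"
    and w: "with_witness c A = (A \<^bold>\<and> subst x (Var (witness c x B)) B)"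
  let ?w = "witness c x B" and ?R = "A \<^bold>\<longrightarrow> \<^bold>\<not> c"
  note wit = witness[of c x B]
  have wf: "wff A" "wff B" "wff c" using adm A by (auto simp: admissible_def)
  have "\<Gamma> \<turnstile> A \<^bold>\<and> subst x (Var ?w) B \<^bold>\<longrightarrow> \<^bold>\<not> c" using imp_swap[OF imp_curry] incons w by simp
  then have "\<Gamma> \<turnstile> subst x (Var ?w) B \<^bold>\<longrightarrow> ?R" using imp_swap[OF imp_curry] by simp
  from gen[OF this, of ?w] have *: "\<Gamma> \<turnstile> \<^bold>\<forall>?w. (subst x (Var ?w) B \<^bold>\<longrightarrow> ?R)" .
  have fresh: "?w \<notin> fv ?R" using wit(3) A by auto
  have ff: "free_for (Var ?w) x B" using adm_witness(2) adm(2) A by simp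
  have "\<Gamma> \<turnstile> B \<^bold>\<longrightarrow> ?R"
    using AllE[OF *, of "Var x"] fresh ff wit
    by (auto simp: subst_back free_for_back free_for_fresh subst_fresh)
  \<comment> \<open>As a bound variable of an admissible formula x is even, while the free variables
    of c are odd.\<close>
  moreover have "x \<notin> fv ?R" using adm A by (auto simp: admissible_def)
  ultimately have "\<Gamma> \<turnstile> A \<^bold>\<longrightarrow> ?R" using ex_elim A by blast
  then show ?thesis using imp_swap imp_contract by blast
qed

lemma chain_inv: "admissible (chain n) \<and> \<not> (\<Gamma> \<turnstile> \<^bold>\<not> chain n)"
proof (induction n)
  case 0
  then show ?case using adm_C cons_C by simp
next
  case (Suc n)
  then show ?case
    using adm_with_witness[of "from_nat n" "chain n"]
      consistent_with_witness[of "chain n" "from_nat n"]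
    by (auto simp: admissible_def)
qed

lemma wff_chain: "wff (chain n)"
  using chain_inv[of n] by (simp add: admissible_def)

lemma chain_mono: "m \<le> n \<Longrightarrow> \<Gamma> \<turnstile> chain n \<^bold>\<longrightarrow> chain m"
proof (induction n)
  case 0
  then show ?case using taut_I wff_chain[of 0] by simp
next
  case (Suc n)
  have "\<Gamma> \<turnstile> chain (Suc n) \<^bold>\<longrightarrow> chain n"
    using taut_AndE1 taut_I wff_chain[of n] adm_with_witness[of "from_nat n" "chain n"]
    by (auto simp: admissible_def)
  then show ?case
    using Suc imp_trans[of "chain (Suc n)" "chain n" "chain m"] taut_I[OF wff_chain[of "Suc n"]]
    by (cases "m = Suc n") (auto simp del: chain.simps)
qed

text \<open>Closed under deduction for all formulas, but maximal on admissible ones only, since no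
  others enter the chain. Hence the admissibility hypotheses in the clauses below.\<close>

definition \<Delta> :: "fm set" where "\<Delta> = {A. \<exists>n. (\<Gamma> \<turnstile> chain n \<^bold>\<longrightarrow> A)}"

lemma \<Delta>_theorem: "\<Gamma> \<turnstile> A \<Longrightarrow> A \<in> \<Delta>"
  using imp_lift wff_chain \<Delta>_def by blast

lemma \<Delta>_mp:
  assumes "(A \<^bold>\<longrightarrow> B) \<in> \<Delta>" "A \<in> \<Delta>" shows "B \<in> \<Delta>"
proof -
  from assms obtain m n where "\<Gamma> \<turnstile> chain m \<^bold>\<longrightarrow> A \<^bold>\<longrightarrow> B" "\<Gamma> \<turnstile> chain n \<^bold>\<longrightarrow> A"
    unfolding \<Delta>_def by auto
  then have "\<Gamma> \<turnstile> chain (max m n) \<^bold>\<longrightarrow> B"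
    using imp_mp imp_trans chain_mono by (meson max.cobounded1 max.cobounded2)
  then show ?thesis unfolding \<Delta>_def by blast
qed

lemma \<Delta>_imp: "\<Gamma> \<turnstile> A \<^bold>\<longrightarrow> B \<Longrightarrow> A \<in> \<Delta> \<Longrightarrow> B \<in> \<Delta>"
  using \<Delta>_mp \<Delta>_theorem by blast

lemma \<Delta>_imp2: "\<Gamma> \<turnstile> A \<^bold>\<longrightarrow> B \<^bold>\<longrightarrow> D \<Longrightarrow> A \<in> \<Delta> \<Longrightarrow> B \<in> \<Delta> \<Longrightarrow> D \<in> \<Delta>"
  using \<Delta>_mp \<Delta>_theorem by blast

lemma Bot_notin_\<Delta>: "\<^bold>\<bottom> \<notin> \<Delta>"
  using chain_inv unfolding \<Delta>_def by blast

lemma C_in_\<Delta>: "C \<in> \<Delta>"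
  using chain_mono[of 0 0] unfolding \<Delta>_def by (metis chain.simps(1) le_refl mem_Collect_eq)

lemma chain_step:
  assumes "admissible A" "(\<^bold>\<not> A) \<notin> \<Delta>"
  obtains n where "with_witness (chain n) A \<in> \<Delta>"
proof -
  let ?n = "to_nat A"
  have "chain (Suc ?n) = (chain ?n \<^bold>\<and> with_witness (chain ?n) A)"
    using assms unfolding \<Delta>_def by auto
  then have "\<Gamma> \<turnstile> chain (Suc ?n) \<^bold>\<longrightarrow> with_witness (chain ?n) A"
    using taut_AndE2 wff_chain[of ?n] adm_with_witness[OF assms(1)] by (auto simp: admissible_def)
  then show thesis using that unfolding \<Delta>_def by blast
qed

section \<open>Truth conditions for connectives and quantifiers\<close>

lemma \<Delta>_Neg:
  assumes "admissible A" shows "(\<^bold>\<not> A) \<in> \<Delta> \<longleftrightarrow> A \<notin> \<Delta>"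
proof
  show "(\<^bold>\<not> A) \<in> \<Delta> \<Longrightarrow> A \<notin> \<Delta>" using \<Delta>_mp Bot_notin_\<Delta> by blast
next
  assume "A \<notin> \<Delta>"
  show "(\<^bold>\<not> A) \<in> \<Delta>"
  proof (rule ccontr)
    assume "(\<^bold>\<not> A) \<notin> \<Delta>"
    then obtain n where *: "with_witness (chain n) A \<in> \<Delta>" using chain_step assms by blast
    have "\<Gamma> \<turnstile> with_witness (chain n) A \<^bold>\<longrightarrow> A"
      by (rule with_witness_cases[of A "chain n"])
        (use adm_with_witness[OF assms, of "chain n"] assms taut_AndE1 taut_I in
          \<open>auto simp: admissible_def\<close>)
    then show False using * \<Delta>_imp \<open>A \<notin> \<Delta>\<close> by blast
  qed
qed

lemma \<Delta>_Imp:
  assumes "admissible A" "admissible B"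
  shows "(A \<^bold>\<longrightarrow> B) \<in> \<Delta> \<longleftrightarrow> (A \<in> \<Delta> \<longrightarrow> B \<in> \<Delta>)"
proof -
  have wf: "wff A" "wff B" using assms by (auto simp: admissible_def)
  show ?thesis
    using \<Delta>_mp \<Delta>_Neg[OF assms(1)] \<Delta>_imp[OF taut_NegE[OF wf]] \<Delta>_imp[OF taut_K[OF wf(2,1)]]
    by blast
qed

lemma \<Delta>_And:
  assumes "admissible A" "admissible B" shows "(A \<^bold>\<and> B) \<in> \<Delta> \<longleftrightarrow> A \<in> \<Delta> \<and> B \<in> \<Delta>"
proof -
  have wf: "wff A" "wff B" using assms by (auto simp: admissible_def)
  show ?thesis
    using \<Delta>_imp[OF taut_AndE1[OF wf]] \<Delta>_imp[OF taut_AndE2[OF wf]] \<Delta>_imp2[OF taut_AndI[OF wf]]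
    by blast
qed

lemma \<Delta>_Or:
  assumes "admissible A" "admissible B" shows "(A \<^bold>\<or> B) \<in> \<Delta> \<longleftrightarrow> A \<in> \<Delta> \<or> B \<in> \<Delta>"
proof -
  have wf: "wff A" "wff B" "wff \<^bold>\<bottom>" using assms by (auto simp: admissible_def)
  show ?thesis
    using \<Delta>_imp[OF taut_OrI1[OF wf(1,2)]] \<Delta>_imp[OF taut_OrI2[OF wf(1,2)]]
      \<Delta>_imp2[OF taut_OrE[OF wf]] \<Delta>_Neg assms \<Delta>_mp Bot_notin_\<Delta>
    by blast
qed

lemma \<Delta>_Ex:
  assumes "admissible (\<^bold>\<exists>x. A)"
  shows "(\<^bold>\<exists>x. A) \<in> \<Delta> \<longleftrightarrow> (\<exists>t. t \<Colon> snd x \<and> fvt t \<subseteq> odd_vars \<and> subst x t A \<in> \<Delta>)"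
proof
  assume "(\<^bold>\<exists>x. A) \<in> \<Delta>"
  then obtain n where *: "with_witness (chain n) (\<^bold>\<exists>x. A) \<in> \<Delta>"
    using chain_step \<Delta>_Neg assms by blast
  let ?w = "witness (chain n) x A"
  have "subst x (Var ?w) A \<in> \<Delta>"
    using * \<Delta>_And[OF assms adm_witness(1)[OF assms]] by (auto simp: with_witness_def)
  then show "\<exists>t. t \<Colon> snd x \<and> fvt t \<subseteq> odd_vars \<and> subst x t A \<in> \<Delta>"
    using witness by (intro exI[of _ "Var ?w"]) auto
next
  assume "\<exists>t. t \<Colon> snd x \<and> fvt t \<subseteq> odd_vars \<and> subst x t A \<in> \<Delta>"
  then obtain t where t: "t \<Colon> snd x" "fvt t \<subseteq> odd_vars" "subst x t A \<in> \<Delta>" by blast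
  moreover have "wff A" "free_for t x A"
    using assms t admissible_subst(2)[of A x t] by (auto simp: admissible_def)
  ultimately show "(\<^bold>\<exists>x. A) \<in> \<Delta>" using \<Delta>_imp ex_inst by blast
qed

lemma \<Delta>_All:
  assumes "admissible (\<^bold>\<forall>x. A)"
  shows "(\<^bold>\<forall>x. A) \<in> \<Delta> \<longleftrightarrow> (\<forall>t. t \<Colon> snd x \<and> fvt t \<subseteq> odd_vars \<longrightarrow> subst x t A \<in> \<Delta>)"
proof
  assume *: "(\<^bold>\<forall>x. A) \<in> \<Delta>"
  show "\<forall>t. t \<Colon> snd x \<and> fvt t \<subseteq> odd_vars \<longrightarrow> subst x t A \<in> \<Delta>"
  proof (intro allI impI)
    fix t assume t: "t \<Colon> snd x \<and> fvt t \<subseteq> odd_vars"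
    moreover have "wff A" "free_for t x A"
      using assms t admissible_subst(2)[of A x t] by (auto simp: admissible_def)
    ultimately show "subst x t A \<in> \<Delta>" using \<Delta>_imp[OF _ *] all_inst by blast
  qed
next
  assume *: "\<forall>t. t \<Colon> snd x \<and> fvt t \<subseteq> odd_vars \<longrightarrow> subst x t A \<in> \<Delta>"
  have adm: "admissible (\<^bold>\<exists>x. \<^bold>\<not> A)" and wf: "wff A" using assms by (auto simp: admissible_def)
  show "(\<^bold>\<forall>x. A) \<in> \<Delta>"
  proof (cases "(\<^bold>\<exists>x. \<^bold>\<not> A) \<in> \<Delta>")
    case True
    then obtain t where "t \<Colon> snd x" "fvt t \<subseteq> odd_vars" "(\<^bold>\<not> subst x t A) \<in> \<Delta>"
      using \<Delta>_Ex[OF adm] by auto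
    then show ?thesis using * \<Delta>_mp Bot_notin_\<Delta> by blast
  next
    case False
    then show ?thesis using \<Delta>_imp[OF not_ex_not[OF wf]] \<Delta>_Neg[OF adm] by blast
  qed
qed

text \<open>Elements are restricted to terms with odd variables, so that none is captured when put
  for a bound variable. Provably equal terms remain distinct here.\<close>

definition term_model :: "trm struc" where
  "term_model = \<lparr>dom = (\<lambda>\<sigma>. {t. t \<Colon> \<sigma> \<and> fvt t \<subseteq> odd_vars}), app = App, con = Con,
     eq0 = (\<lambda>s t. (s \<^bold>= t) \<in> \<Delta>), std = (\<lambda>t. St t \<in> \<Delta>)\<rparr>"

lemma val_term_model: "val term_model e t = psubst_t e t"
  by (induction t) (auto simp: term_model_def)

lemma struct_term_model: "struct term_model"
  by (auto simp: struct_def term_model_def)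

text \<open>The truth lemma. The environment must stay arbitrary, since the quantifier cases assign
  terms to bound variables; the hypotheses make each resulting formula admissible, where the clauses
  for \<Delta> apply.\<close>

lemma sat_term_model:
  assumes "wff A" "bv A \<inter> odd_vars = {}" "\<And>v. e v \<Colon> snd v \<and> fvt (e v) \<subseteq> odd_vars"
  shows "sat term_model A e \<longleftrightarrow> psubst A e \<in> \<Delta>"
  using assms
proof (induction A arbitrary: e)
  case (Eq s t)
  then show ?case by (simp add: val_term_model) (simp add: term_model_def)
next
  case (St t)
  then show ?case by (simp add: val_term_model) (simp add: term_model_def)
next
  case Bot
  then show ?case using Bot_notin_\<Delta> by simp
next
  case (Imp A B)
  have "admissible (psubst A e)" "admissible (psubst B e)"
    using Imp.prems(1,2) by (intro admissible_psubst Imp.prems(3); auto)+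
  moreover have "bv A \<inter> odd_vars = {}" "bv B \<inter> odd_vars = {}" using Imp.prems by auto
  ultimately show ?case using Imp \<Delta>_Imp by simp
next
  case (And A B)
  have "admissible (psubst A e)" "admissible (psubst B e)"
    using And.prems(1,2) by (intro admissible_psubst And.prems(3); auto)+
  moreover have "bv A \<inter> odd_vars = {}" "bv B \<inter> odd_vars = {}" using And.prems by auto
  ultimately show ?case using And \<Delta>_And by simp
next
  case (Or A B)
  have "admissible (psubst A e)" "admissible (psubst B e)"
    using Or.prems(1,2) by (intro admissible_psubst Or.prems(3); auto)+
  moreover have "bv A \<inter> odd_vars = {}" "bv B \<inter> odd_vars = {}" using Or.prems by auto
  ultimately show ?case using Or \<Delta>_Or by simp
next
  case (All x A)
  have adm: "admissible (\<^bold>\<forall>x. psubst A (e(x := Var x)))"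
    using admissible_psubst[of "\<^bold>\<forall>x. A" e] All.prems by simp
  have "subst x t (psubst A (e(x := Var x))) = psubst A (e(x := t))" for t
    using All.prems by (intro subst_psubst) auto
  moreover have "sat term_model A (e(x := t)) \<longleftrightarrow> psubst A (e(x := t)) \<in> \<Delta>"
    if "t \<Colon> snd x" "fvt t \<subseteq> odd_vars" for t
    using All.prems that by (intro All.IH) auto
  ultimately show ?case using \<Delta>_All[OF adm] by (auto simp: term_model_def)
next
  case (Ex x A)
  have adm: "admissible (\<^bold>\<exists>x. psubst A (e(x := Var x)))"
    using admissible_psubst[of "\<^bold>\<exists>x. A" e] Ex.prems by simp
  have "subst x t (psubst A (e(x := Var x))) = psubst A (e(x := t))" for t
    using Ex.prems by (intro subst_psubst) auto
  moreover have "sat term_model A (e(x := t)) \<longleftrightarrow> psubst A (e(x := t)) \<in> \<Delta>"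
    if "t \<Colon> snd x" "fvt t \<subseteq> odd_vars" for t
    using Ex.prems that by (intro Ex.IH) auto
  ultimately show ?case using \<Delta>_Ex[OF adm] by (auto simp: term_model_def)
qed

end

section \<open>The completeness theorem\<close>

lemma index_bound: obtains m where "\<And>v. v \<in> fv A \<union> bv A \<Longrightarrow> fst v < m"
proof -
  have "finite (fst ` (fv A \<union> bv A))" by simp
  then show thesis using that unfolding finite_nat_set_iff_bounded by auto
qed

lemma bv_ren_even: "bv (ren m A) \<inter> odd_vars = {}"
  by (auto simp: bv_ren shift_def odd_vars_def)

theorem completeness:
  assumes closed: "\<And>B. B \<in> \<Gamma> \<Longrightarrow> fv B = {}" and A: "fv A = {}" "wff A"
    and valid: "\<And>(M :: trm struc) e. \<lbrakk>struct M; env M e;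
      \<And>B e. \<lbrakk>B \<in> \<Gamma>; wff B; env M e\<rbrakk> \<Longrightarrow> sat M B e\<rbrakk> \<Longrightarrow> sat M A e"
  shows "\<Gamma> \<turnstile> A"
proof (rule ccontr)
  assume not: "\<not> (\<Gamma> \<turnstile> A)"
  interpret sentences \<Gamma> using closed by unfold_locales
  obtain m where m: "\<And>v. v \<in> fv A \<union> bv A \<Longrightarrow> fst v < m" using index_bound[of A] by blast
  interpret henkin \<Gamma> "\<^bold>\<not> ren m A"
  proof unfold_locales
    show "admissible (\<^bold>\<not> ren m A)"
      using A fv_ren[of m A] bv_ren_even[of m A] by (auto simp: admissible_def)
    show "\<not> (\<Gamma> \<turnstile> \<^bold>\<not> \<^bold>\<not> ren m A)"
      using not ren_equiv[OF A(2) m] taut_DN[of "ren m A"] A(2) ImpE by auto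
  qed
  have sat_iff: "sat term_model B e \<longleftrightarrow> ren k B \<in> \<Delta>"
    if B: "wff B" "fv B = {}" "env term_model e" "\<And>v. v \<in> fv B \<union> bv B \<Longrightarrow> fst v < k" for B e k
  proof -
    have "sat term_model B e \<longleftrightarrow> sat term_model (ren k B) e" using sat_ren B(4) by blast
    also have "\<dots> \<longleftrightarrow> psubst (ren k B) e \<in> \<Delta>"
      using B bv_ren_even by (intro sat_term_model) (auto simp: env_def term_model_def)
    also have "psubst (ren k B) e = ren k B" using fv_ren[of k B] B(2) by (intro psubst_id) auto
    finally show ?thesis .
  qed
  have "sat term_model B e" if B: "B \<in> \<Gamma>" "wff B" "env term_model e" for B e
  proof -
    obtain k where k: "\<And>v. v \<in> fv B \<union> bv B \<Longrightarrow> fst v < k" using index_bound[of B] by blast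
    have "\<Gamma> \<turnstile> ren k B" using ImpE Assm B ren_equiv[OF B(2) k] by blast
    then show ?thesis using sat_iff[OF B(2) closed[OF B(1)] B(3) k] \<Delta>_theorem by simp
  qed
  \<comment> \<open>The formulas in question are sentences, so any environment would serve. This one
    turns each variable into an odd one of the same type.\<close>
  moreover have e: "env term_model (\<lambda>v. Var (2 * fst v + 1, snd v))"
    by (simp add: env_def term_model_def odd_vars_def)
  ultimately have "sat term_model A (\<lambda>v. Var (2 * fst v + 1, snd v))"
    using valid struct_term_model by blast
  then have "ren m A \<in> \<Delta>" using sat_iff[OF A(2,1) e m] by simp
  then show False using C_in_\<Delta> \<Delta>_mp Bot_notin_\<Delta> by blast
qed


section \<open>Models of \<open>P\<^sub>0 + SOT + STP\<^sub>2\<close>\<close>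

lemma fv_foldr_All: "fv (foldr All xs A) = fv A - set xs"
  by (induction xs) auto

lemma wff_foldr_All [simp]: "wff (foldr All xs A) = wff A"
  by (induction xs) auto

lemma sat_foldr_AllD: "sat M (foldr All xs A) e \<Longrightarrow> env M e \<Longrightarrow> sat M A e"
proof (induction xs)
  case (Cons x xs)
  have "e x \<in> dom M (snd x)" using Cons.prems(2) by (cases x) (simp add: env_def)
  then have "sat M (foldr All xs A) (e(x := e x))" using Cons.prems(1) by auto
  then show ?case using Cons by simp
qed simp

lemma closure_in_closures: "A \<in> X \<Longrightarrow> \<exists>xs. foldr All xs A \<in> closures X"
  using finite_list[OF finite_fv[of A]] unfolding closures_def
  by (force simp: fv_foldr_All)

section \<open>Typing and free variables of the defined terms and formulas\<close>

lemma fvt_lam [simp]: "fvt (lam v t) = fvt t - {v}"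
  by (induction t) auto

lemma tyof_lam [simp]: "tyof (lam v t) = map_option (\<lambda>\<tau>. snd v \<leadsto> \<tau>) (tyof t)"
  by (induction t) (auto simp: tyof.simps(3) split: option.splits ty.splits)

lemma tyof_predec [simp]: "tyof predec = Some (TN \<leadsto> TN)"
  by (simp add: predec_def tyof.simps(3))

lemma fvt_predec [simp]: "fvt predec = {}"
  by (auto simp: predec_def)

text \<open>Naming the closed functional that \<open>monus\<close> iterates keeps its combinator
  expansion away from the simplifier.\<close>

definition step_pred :: trm where
  "step_pred = lam (0, TN) (lam (1, TN) (predec \<cdot> Var (0, TN)))"

lemma tyof_step_pred [simp]: "tyof step_pred = Some (TN \<leadsto> TN \<leadsto> TN)"
  by (simp add: step_pred_def tyof.simps(3))

lemma fvt_step_pred [simp]: "fvt step_pred = {}"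
  by (auto simp: step_pred_def)

lemma monus_step_pred: "monus s t = Con CRec \<cdot> t \<cdot> s \<cdot> step_pred"
  by (simp add: monus_def step_pred_def)

lemma tyof_monus [simp]:
  "tyof (monus s t) = (if tyof s = Some TN \<and> tyof t = Some TN then Some TN else None)"
  by (simp add: monus_step_pred tyof.simps(3))

lemma fvt_monus [simp]: "fvt (monus s t) = fvt s \<union> fvt t"
  by (auto simp: monus_step_pred)

declare lam.simps [simp del]

lemma fresh_notin: "finite V \<Longrightarrow> (fresh V, \<sigma>) \<notin> V"
proof -
  assume "finite V"
  then have "\<exists>n. n \<notin> fst ` V" using ex_new_if_finite[of "fst ` V"] by auto
  from LeastI_ex[OF this] show ?thesis unfolding fresh_def by force
qed

lemma wff_eq [simp]: "s \<Colon> \<sigma> \<Longrightarrow> t \<Colon> \<sigma> \<Longrightarrow> wff (eq \<sigma> s t)"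
  by (induction \<sigma> arbitrary: s t) (auto simp: Let_def le_def lt_def)

lemma wff_mem [simp]: "z \<Colon> \<sigma> \<Longrightarrow> s \<Colon> Seq \<sigma> \<Longrightarrow> wff (mem \<sigma> z s)"
  by (simp add: mem_def Let_def le_def lt_def)

lemma fv_eq: "fv (eq \<sigma> s t) \<subseteq> fvt s \<union> fvt t"
proof (induction \<sigma> arbitrary: s t)
  case (Fn \<sigma> \<tau>)
  let ?x = "Var (fresh (fvt s \<union> fvt t), \<sigma>)"
  show ?case using Fn.IH(2)[of "s \<cdot> ?x" "t \<cdot> ?x"] by (auto simp: Let_def)
next
  case (Seq \<sigma>)
  let ?i = "Var (fresh (fvt s \<union> fvt t), TN)"
  show ?case using Seq.IH[of "proj \<sigma> s ?i" "proj \<sigma> t ?i"] by (auto simp: Let_def lt_def le_def)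
qed simp

lemma internal_eq [simp]: "internal (eq \<sigma> s t)"
  by (induction \<sigma> arbitrary: s t) (auto simp: Let_def lt_def le_def)

lemma fv_mem: "fv (mem \<sigma> z s) \<subseteq> fvt z \<union> fvt s"
  using fv_eq by (fastforce simp: mem_def Let_def lt_def le_def)

lemma internal_mem [simp]: "internal (mem \<sigma> z s)"
  by (simp add: mem_def Let_def lt_def le_def)

text \<open>The environment may be \<open>undefined\<close> because \<open>step_pred\<close> is
  closed.\<close>

definition MON :: "'a struc \<Rightarrow> 'a \<Rightarrow> 'a \<Rightarrow> 'a" where
  "MON M a b = app M (app M (app M (con M CRec) b) a) (val M undefined step_pred)"

definition LT :: "'a struc \<Rightarrow> 'a \<Rightarrow> 'a \<Rightarrow> bool" where
  "LT M a b \<longleftrightarrow> eq0 M (MON M (app M (con M CSucc) a) b) (con M CZero)"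

abbreviation lenM :: "'a struc \<Rightarrow> ty \<Rightarrow> 'a \<Rightarrow> 'a" where
  "lenM M \<sigma> s \<equiv> app M (con M (CLen \<sigma>)) s"

abbreviation projM :: "'a struc \<Rightarrow> ty \<Rightarrow> 'a \<Rightarrow> 'a \<Rightarrow> 'a" where
  "projM M \<sigma> s i \<equiv> app M (app M (con M (CProj \<sigma>)) s) i"

text \<open>Mirrors \<open>eq\<close> on elements, which gets rid of the fresh variables that
  \<open>eq\<close> chooses according to its term arguments.\<close>

primrec EQ :: "'a struc \<Rightarrow> ty \<Rightarrow> 'a \<Rightarrow> 'a \<Rightarrow> bool" where
  "EQ M TN a b = eq0 M a b"
| "EQ M (\<sigma> \<leadsto> \<tau>) a b = (\<forall>c \<in> dom M \<sigma>. EQ M \<tau> (app M a c) (app M b c))"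
| "EQ M (Seq \<sigma>) a b = (eq0 M (lenM M \<sigma> a) (lenM M \<sigma> b) \<and>
     (\<forall>i \<in> dom M TN. LT M i (lenM M \<sigma> a) \<longrightarrow> EQ M \<sigma> (projM M \<sigma> a i) (projM M \<sigma> b i)))"

lemma val_closed: "fvt t = {} \<Longrightarrow> val M e t = val M e' t"
  by (rule val_cong) simp

lemma val_monus [simp]: "val M e (monus s t) = MON M (val M e s) (val M e t)"
  by (simp add: monus_step_pred MON_def val_closed[of step_pred M e undefined])

lemma sat_le [simp]: "sat M (s \<^bold>\<le> t) e = eq0 M (MON M (val M e s) (val M e t)) (con M CZero)"
  by (simp add: le_def)

lemma sat_lt [simp]: "sat M (s \<^bold>< t) e = LT M (val M e s) (val M e t)"
  by (simp add: lt_def LT_def)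

lemma sat_eq [simp]: "sat M (eq \<sigma> s t) e = EQ M \<sigma> (val M e s) (val M e t)"
proof (induction \<sigma> arbitrary: s t e)
  case (Fn \<sigma> \<tau>)
  let ?x = "(fresh (fvt s \<union> fvt t), \<sigma>)"
  have "?x \<notin> fvt s \<union> fvt t" by (rule fresh_notin) simp
  moreover have "sat M (eq \<tau> s t) e = EQ M \<tau> (val M e s) (val M e t)" for s t e by (rule Fn.IH)
  ultimately show ?case by (simp add: Let_def)
next
  case (Seq \<sigma>)
  let ?x = "(fresh (fvt s \<union> fvt t), TN)"
  have "?x \<notin> fvt s \<union> fvt t" by (rule fresh_notin) simp
  moreover have "sat M (eq \<sigma> s t) e = EQ M \<sigma> (val M e s) (val M e t)" for s t e by (rule Seq.IH)
  ultimately show ?case by (simp add: Let_def)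
qed simp

lemma sat_mem [simp]:
  "sat M (mem \<sigma> z s) e \<longleftrightarrow> (\<exists>i \<in> dom M TN. LT M i (lenM M \<sigma> (val M e s)) \<and>
     EQ M \<sigma> (val M e z) (projM M \<sigma> (val M e s) i))"
proof -
  let ?x = "(fresh (fvt z \<union> fvt s), TN)"
  have "?x \<notin> fvt z \<union> fvt s" by (rule fresh_notin) simp
  then show ?thesis by (simp add: mem_def Let_def)
qed

lemma tyof_zero_of [simp]: "tyof (zero_of \<sigma>) = Some \<sigma>"
  by (induction \<sigma>) auto

lemma fvt_zero_of [simp]: "fvt (zero_of \<sigma>) = {}"
  by (induction \<sigma>) auto

text \<open>\<open>zero_of\<close> inhabits every domain, which provides a total environment that is
  then updated at the few variables that matter.\<close>

definition default_env :: "'a struc \<Rightarrow> var \<Rightarrow> 'a" where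
  "default_env M v = val M undefined (zero_of (snd v))"

definition axioms :: "fm set" where
  "axioms = EPRA \<union> Tst \<union> Ideal \<union> {SOT, STP2}"

section \<open>Extensional equality in a model is a congruence\<close>

locale P0_model =
  fixes M :: "'a struc"
  assumes struct: "struct M"
    and axiom: "A \<in> axioms \<Longrightarrow> wff A \<Longrightarrow> env M e \<Longrightarrow> sat M A e"
begin

lemma con_dom [simp]: "con M c \<in> dom M \<sigma>" if "ctype c = \<sigma>"
  using struct that by (auto simp: struct_def)

lemma app_dom: "f \<in> dom M (\<sigma> \<leadsto> \<tau>) \<Longrightarrow> a \<in> dom M \<sigma> \<Longrightarrow> app M f a \<in> dom M \<tau>"
  using struct by (auto simp: struct_def)

lemma val_closed_dom: "fvt t = {} \<Longrightarrow> t \<Colon> \<sigma> \<Longrightarrow> val M e t \<in> dom M \<sigma>"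
  by (induction t arbitrary: \<sigma>) (auto intro: app_dom)

lemma default_env [simp]: "env M (default_env M)"
  by (simp add: env_def default_env_def val_closed_dom)

lemma val_dom [simp]: "env M e \<Longrightarrow> tyof t = Some \<sigma> \<Longrightarrow> val M e t \<in> dom M \<sigma>"
  using val_in_dom struct by blast

text \<open>The pattern for reading off axioms: the schema is instantiated with variables, and an
  environment assigns the given elements to them.\<close>

lemma eq0_refl: "a \<in> dom M TN \<Longrightarrow> eq0 M a a"
  using axiom[of "Var (0, TN) \<^bold>= Var (0, TN)" "(default_env M)((0, TN) := a)"]
  by (simp add: axioms_def EPRA.eq_refl)

lemma eq0_euclid:
  assumes "a \<in> dom M TN" "b \<in> dom M TN" "c \<in> dom M TN" "eq0 M a b" "eq0 M a c"
  shows "eq0 M b c"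
  using assms axiom[of "Var (0, TN) \<^bold>= Var (1, TN) \<^bold>\<longrightarrow> Var (0, TN) \<^bold>= Var (2, TN) \<^bold>\<longrightarrow> Var (1, TN) \<^bold>= Var (2, TN)"
      "(default_env M)((0, TN) := a, (1, TN) := b, (2, TN) := c)"]
  by (simp add: axioms_def EPRA.eq_euclid)

lemma EQ_ext:
  assumes "a \<in> dom M \<sigma>" "b \<in> dom M \<sigma>" "u \<in> dom M (\<sigma> \<leadsto> \<tau>)" "EQ M \<sigma> a b"
  shows "EQ M \<tau> (app M u a) (app M u b)"
  using assms axiom[of "eq \<sigma> (Var (0, \<sigma>)) (Var (1, \<sigma>)) \<^bold>\<longrightarrow>
      eq \<tau> (Var (2, \<sigma> \<leadsto> \<tau>) \<cdot> Var (0, \<sigma>)) (Var (2, \<sigma> \<leadsto> \<tau>) \<cdot> Var (1, \<sigma>))"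
      "(default_env M)((0, \<sigma>) := a, (1, \<sigma>) := b, (2, \<sigma> \<leadsto> \<tau>) := u)"]
  by (simp add: axioms_def EPRA.ext)

lemma MON_dom [simp]: "a \<in> dom M TN \<Longrightarrow> b \<in> dom M TN \<Longrightarrow> MON M a b \<in> dom M TN"
  unfolding MON_def
  by (rule app_dom[of _ "TN \<leadsto> TN \<leadsto> TN"], rule app_dom[of _ TN], rule app_dom[of _ TN])
    (simp_all add: val_closed_dom)

text \<open>Extensionality of the recursor in its first argument. It is needed because
  \<open>EQ\<close> at a sequence type bounds indices by the length of the left sequence, and the
  left sequence changes in \<open>EQ_euclid\<close>.\<close>

lemma LT_cong:
  assumes "i \<in> dom M TN" "a \<in> dom M TN" "b \<in> dom M TN" "eq0 M a b" "LT M i a"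
  shows "LT M i b"
proof -
  let ?s = "app M (con M CSucc) i"
  have s: "?s \<in> dom M TN" using assms(1) app_dom[of _ TN TN] by simp
  have "EQ M (TN \<leadsto> (TN \<leadsto> TN \<leadsto> TN) \<leadsto> TN) (app M (con M CRec) a) (app M (con M CRec) b)"
    using assms by (intro EQ_ext[of a TN b]) auto
  then have "eq0 M (MON M ?s a) (MON M ?s b)"
    using s by (simp add: MON_def val_closed_dom)
  from eq0_euclid[OF _ _ _ this] show ?thesis using assms s unfolding LT_def by simp
qed

lemma EQ_refl: "a \<in> dom M \<sigma> \<Longrightarrow> EQ M \<sigma> a a"
proof (induction \<sigma> arbitrary: a)
  case (Seq \<sigma>)
  moreover have "lenM M \<sigma> a \<in> dom M TN" using Seq.prems by (intro app_dom[of _ "Seq \<sigma>"]) simp_all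
  moreover have "projM M \<sigma> a i \<in> dom M \<sigma>" if "i \<in> dom M TN" for i
    using Seq.prems that by (intro app_dom[of _ TN] app_dom[of _ "Seq \<sigma>"]) auto
  ultimately show ?case by (auto intro: eq0_refl)
qed (auto intro: eq0_refl app_dom)

lemma EQ_euclid:
  "\<lbrakk>a \<in> dom M \<sigma>; b \<in> dom M \<sigma>; c \<in> dom M \<sigma>; EQ M \<sigma> a b; EQ M \<sigma> a c\<rbrakk> \<Longrightarrow> EQ M \<sigma> b c"
proof (induction \<sigma> arbitrary: a b c)
  case TN
  then show ?case using eq0_euclid[of a b c] by simp
next
  case (Fn \<sigma> \<tau>)
  have "EQ M \<tau> (app M b d) (app M c d)" if "d \<in> dom M \<sigma>" for d
    by (rule Fn.IH(2)[of "app M a d"]) (use Fn.prems that app_dom in auto)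
  then show ?case by simp
next
  case (Seq \<sigma>)
  have len: "lenM M \<sigma> d \<in> dom M TN" if "d \<in> dom M (Seq \<sigma>)" for d
    using that by (intro app_dom[of _ "Seq \<sigma>"]) auto
  have proj: "projM M \<sigma> d i \<in> dom M \<sigma>" if "d \<in> dom M (Seq \<sigma>)" "i \<in> dom M TN" for d i
    using that by (intro app_dom[of _ TN] app_dom[of _ "Seq \<sigma>"]) auto
  note L = len[OF Seq.prems(1)] len[OF Seq.prems(2)] len[OF Seq.prems(3)]
  have ba: "eq0 M (lenM M \<sigma> b) (lenM M \<sigma> a)"
    using eq0_euclid[OF L(1,2,1)] eq0_refl[OF L(1)] Seq.prems(4) by simp
  have "EQ M \<sigma> (projM M \<sigma> b i) (projM M \<sigma> c i)" if i: "i \<in> dom M TN" "LT M i (lenM M \<sigma> b)" for i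
  proof -
    have "LT M i (lenM M \<sigma> a)" using LT_cong[OF i(1) L(2,1) ba i(2)] .
    then show ?thesis
      using Seq.IH[of "projM M \<sigma> a i" "projM M \<sigma> b i" "projM M \<sigma> c i"] Seq.prems proj[OF _ i(1)] i(1)
      by simp
  qed
  moreover have "eq0 M (lenM M \<sigma> b) (lenM M \<sigma> c)"
    using eq0_euclid[OF L] Seq.prems(4,5) by simp
  ultimately show ?case by simp
qed

lemma EQ_sym: "\<lbrakk>a \<in> dom M \<sigma>; b \<in> dom M \<sigma>; EQ M \<sigma> a b\<rbrakk> \<Longrightarrow> EQ M \<sigma> b a"
  using EQ_euclid EQ_refl by blast

lemma EQ_trans: "\<lbrakk>a \<in> dom M \<sigma>; b \<in> dom M \<sigma>; c \<in> dom M \<sigma>; EQ M \<sigma> a b; EQ M \<sigma> b c\<rbrakk> \<Longrightarrow> EQ M \<sigma> a c"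
  using EQ_euclid EQ_sym by blast

lemma EQ_app:
  assumes "f \<in> dom M (\<sigma> \<leadsto> \<tau>)" "g \<in> dom M (\<sigma> \<leadsto> \<tau>)" "a \<in> dom M \<sigma>" "b \<in> dom M \<sigma>"
    "EQ M (\<sigma> \<leadsto> \<tau>) f g" "EQ M \<sigma> a b"
  shows "EQ M \<tau> (app M f a) (app M g b)"
  by (rule EQ_trans[of _ _ "app M f b"]) (use assms app_dom EQ_ext in auto)

lemma std_cong:
  assumes "a \<in> dom M \<sigma>" "b \<in> dom M \<sigma>" "EQ M \<sigma> a b" "std M a" shows "std M b"
  using assms axiom[of "St (Var (0, \<sigma>)) \<^bold>\<and> eq \<sigma> (Var (0, \<sigma>)) (Var (1, \<sigma>)) \<^bold>\<longrightarrow> St (Var (1, \<sigma>))"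
      "(default_env M)((0, \<sigma>) := a, (1, \<sigma>) := b)"]
  by (simp add: axioms_def Tst.st_eq)

end


section \<open>The extensional quotient\<close>

text \<open>The type tag is there because application in a structure receives no type:
  \<open>app_cls\<close> reads the result type off the tag of the function.\<close>

definition cls :: "'a struc \<Rightarrow> ty \<Rightarrow> 'a \<Rightarrow> ty \<times> 'a set" where
  "cls M \<sigma> a = (\<sigma>, {b \<in> dom M \<sigma>. EQ M \<sigma> a b})"

definition app_cls :: "'a struc \<Rightarrow> ty \<times> 'a set \<Rightarrow> ty \<times> 'a set \<Rightarrow> ty \<times> 'a set" where
  "app_cls M f a = (case fst f of
      \<sigma> \<leadsto> \<tau> \<Rightarrow> (\<tau>, {c \<in> dom M \<tau>. \<exists>g \<in> snd f. \<exists>b \<in> snd a. EQ M \<tau> (app M g b) c})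
    | _ \<Rightarrow> undefined)"

definition quot :: "'a struc \<Rightarrow> (ty \<times> 'a set) struc" where
  "quot M = \<lparr>dom = (\<lambda>\<sigma>. cls M \<sigma> ` dom M \<sigma>), app = app_cls M,
     con = (\<lambda>c. cls M (ctype c) (con M c)), eq0 = (=), std = (\<lambda>a. \<exists>b \<in> snd a. std M b)\<rparr>"

context P0_model
begin

lemma cls_eq_iff:
  "a \<in> dom M \<sigma> \<Longrightarrow> b \<in> dom M \<sigma> \<Longrightarrow> cls M \<sigma> a = cls M \<sigma> b \<longleftrightarrow> EQ M \<sigma> a b"
  unfolding cls_def using EQ_refl EQ_sym EQ_trans by blast

lemma app_cls:
  assumes "f \<in> dom M (\<sigma> \<leadsto> \<tau>)" "a \<in> dom M \<sigma>"
  shows "app_cls M (cls M (\<sigma> \<leadsto> \<tau>) f) (cls M \<sigma> a) = cls M \<tau> (app M f a)"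
proof -
  have "(\<exists>g \<in> {g \<in> dom M (\<sigma> \<leadsto> \<tau>). EQ M (\<sigma> \<leadsto> \<tau>) f g}. \<exists>b \<in> {b \<in> dom M \<sigma>. EQ M \<sigma> a b}.
      EQ M \<tau> (app M g b) c) \<longleftrightarrow> EQ M \<tau> (app M f a) c" (is "?l \<longleftrightarrow> ?r") if c: "c \<in> dom M \<tau>" for c
  proof
    assume ?l
    then obtain g b where "g \<in> dom M (\<sigma> \<leadsto> \<tau>)" "EQ M (\<sigma> \<leadsto> \<tau>) f g" "b \<in> dom M \<sigma>" "EQ M \<sigma> a b"
      "EQ M \<tau> (app M g b) c" by blast
    then show ?r using EQ_app[of f \<sigma> \<tau> g a b] EQ_trans[of _ \<tau> "app M g b"] c assms app_dom by blast
  next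
    assume ?r
    then show ?l using assms EQ_refl by blast
  qed
  then show ?thesis by (auto simp: app_cls_def cls_def simp del: EQ.simps)
qed

lemma std_cls:
  assumes "a \<in> dom M \<sigma>" shows "std (quot M) (cls M \<sigma> a) \<longleftrightarrow> std M a"
proof -
  have "std (quot M) (cls M \<sigma> a) \<longleftrightarrow> (\<exists>b \<in> dom M \<sigma>. EQ M \<sigma> a b \<and> std M b)"
    by (auto simp: quot_def cls_def)
  then show ?thesis using assms std_cong EQ_sym EQ_refl by blast
qed

lemma val_quot:
  "env M e \<Longrightarrow> t \<Colon> \<sigma> \<Longrightarrow> val (quot M) (\<lambda>v. cls M (snd v) (e v)) t = cls M \<sigma> (val M e t)"
proof (induction t arbitrary: \<sigma>)
  case (App t u)
  then obtain \<rho> where "t \<Colon> \<rho> \<leadsto> \<sigma>" "u \<Colon> \<rho>" by auto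
  then show ?case using App app_cls[of "val M e t" \<rho> \<sigma> "val M e u"] by (simp add: quot_def)
qed (auto simp: quot_def)

lemma cls_upd: "(\<lambda>v. cls M (snd v) (e v))(x := cls M (snd x) a) = (\<lambda>v. cls M (snd v) ((e(x := a)) v))"
  by (auto simp: fun_eq_iff)

lemma sat_quot:
  "env M e \<Longrightarrow> wff A \<Longrightarrow> sat (quot M) A (\<lambda>v. cls M (snd v) (e v)) \<longleftrightarrow> sat M A e"
proof (induction A arbitrary: e)
  case (Eq s t)
  then show ?case using cls_eq_iff[of "val M e s" TN "val M e t"]
    by (auto simp: val_quot) (auto simp: quot_def)
next
  case (St t)
  then obtain \<sigma> where "t \<Colon> \<sigma>" by auto
  then show ?case using St by (simp add: val_quot std_cls)
next
  case (All x A)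
  have "dom (quot M) (snd x) = cls M (snd x) ` dom M (snd x)" by (simp add: quot_def)
  moreover have "sat (quot M) A ((\<lambda>v. cls M (snd v) (e v))(x := cls M (snd x) a)) \<longleftrightarrow> sat M A (e(x := a))"
    if "a \<in> dom M (snd x)" for a
    unfolding cls_upd by (rule All.IH[OF env_upd]) (use All.prems that in auto)
  ultimately show ?case by simp
next
  case (Ex x A)
  have "dom (quot M) (snd x) = cls M (snd x) ` dom M (snd x)" by (simp add: quot_def)
  moreover have "sat (quot M) A ((\<lambda>v. cls M (snd v) (e v))(x := cls M (snd x) a)) \<longleftrightarrow> sat M A (e(x := a))"
    if "a \<in> dom M (snd x)" for a
    unfolding cls_upd by (rule Ex.IH[OF env_upd]) (use Ex.prems that in auto)
  ultimately show ?case by simp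
qed auto

lemma struct_quot: "struct (quot M)"
  using app_cls app_dom by (auto simp: struct_def quot_def)

lemma env_quot: "env M e \<Longrightarrow> env (quot M) (\<lambda>v. cls M (snd v) (e v))"
  by (auto simp: env_def quot_def)

lemma env_quotE:
  assumes "env (quot M) e" obtains e' where "env M e'" "e = (\<lambda>v. cls M (snd v) (e' v))"
proof -
  have "\<forall>v. \<exists>a. a \<in> dom M (snd v) \<and> e v = cls M (snd v) a" using assms by (force simp: env_def quot_def)
  then obtain e' where "\<forall>v. e' v \<in> dom M (snd v) \<and> e v = cls M (snd v) (e' v)" by metis
  moreover from this have "e = (\<lambda>v. cls M (snd v) (e' v))" by blast
  ultimately show thesis using that[of e'] unfolding env_def by blast
qed

text \<open>\<open>EQ\<close> is the truth of the formula \<open>eq\<close>, so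
  \<open>sat_quot\<close> carries it from classes back to representatives, whose classes then
  coincide.\<close>

lemma quot_EQ:
  assumes "a \<in> dom (quot M) \<sigma>" "b \<in> dom (quot M) \<sigma>" "EQ (quot M) \<sigma> a b" shows "a = b"
proof -
  from assms obtain a' b' where ab: "a' \<in> dom M \<sigma>" "a = cls M \<sigma> a'" "b' \<in> dom M \<sigma>" "b = cls M \<sigma> b'"
    by (auto simp: quot_def)
  let ?e = "(default_env M)((0, \<sigma>) := a', (1, \<sigma>) := b')"
  have "EQ M \<sigma> a' b'"
    using sat_quot[of ?e "eq \<sigma> (Var (0, \<sigma>)) (Var (1, \<sigma>))"] ab assms(3) by simp
  then show ?thesis using ab cls_eq_iff by blast
qed

end

locale normal_model = P0_model +
  assumes EQ_imp_eq: "a \<in> dom M \<sigma> \<Longrightarrow> b \<in> dom M \<sigma> \<Longrightarrow> EQ M \<sigma> a b \<Longrightarrow> a = b"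
    and eq0 [simp]: "eq0 M = (=)"

lemma (in P0_model) normal_quot: "normal_model (quot M)"
proof unfold_locales
  show "sat (quot M) A e" if "A \<in> axioms" "wff A" "env (quot M) e" for A e
    using that env_quotE[of e] sat_quot axiom by metis
qed (use struct_quot quot_EQ in \<open>auto simp: quot_def\<close>)


section \<open>Arithmetic in normal models\<close>

definition add_step :: trm where
  "add_step = lam (0, TN) (lam (1, TN) (suc (Var (0, TN))))"

lemma tyof_add_step [simp]: "tyof add_step = Some (TN \<leadsto> TN \<leadsto> TN)"
  by (simp add: add_step_def tyof.simps(3))

lemma fvt_add_step [simp]: "fvt add_step = {}"
  by (auto simp: add_step_def)

text \<open>\<open>search \<cdot> g \<cdot> n\<close> is \<open>0\<close> if \<open>g i = 0\<close> for some \<open>i < n\<close>, and \<open>1\<close> otherwise.\<close>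

definition search :: trm where
  "search = lam (0, T1) (lam (0, TN) (Con CRec \<cdot> Var (0, TN) \<cdot> one \<cdot>
     lam (1, TN) (lam (2, TN) (Con CRec \<cdot> (Var (0, T1) \<cdot> Var (2, TN)) \<cdot> zero \<cdot>
       lam (3, TN) (lam (4, TN) (Var (1, TN)))))))"

lemma tyof_search [simp]: "tyof search = Some (T1 \<leadsto> TN \<leadsto> TN)"
  by (simp add: search_def tyof.simps(3))

lemma fvt_search [simp]: "fvt search = {}"
  by (auto simp: search_def)

lemma qf_bv: "qf A \<Longrightarrow> bv A = {}"
  by (induction A) auto

context normal_model
begin

abbreviation ap (infixl "\<bullet>" 75) where "f \<bullet> a \<equiv> app M f a"
abbreviation "N \<equiv> dom M TN"
abbreviation "zr \<equiv> con M CZero"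
abbreviation "sc n \<equiv> con M CSucc \<bullet> n"
abbreviation "d0 \<equiv> default_env M"

section \<open>Combinators, standardness and recursion\<close>

lemma K_eq:
  assumes "a \<in> dom M \<sigma>" "b \<in> dom M \<tau>" shows "con M (CK \<sigma> \<tau>) \<bullet> a \<bullet> b = a"
proof -
  let ?t = "Con (CK \<sigma> \<tau>) \<cdot> Var (0, \<sigma>) \<cdot> Var (1, \<tau>)" and ?e = "d0((0, \<sigma>) := a, (1, \<tau>) := b)"
  have "sat M (eq \<sigma> ?t (Var (0, \<sigma>))) ?e"
    using assms by (intro axiom) (auto simp: axioms_def EPRA.K)
  moreover have "val M ?e ?t \<in> dom M \<sigma>" by (rule val_dom) (use assms in auto)
  ultimately show ?thesis using EQ_imp_eq[of _ \<sigma> a] assms by simp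
qed

lemma S_eq:
  assumes "f \<in> dom M (\<rho> \<leadsto> \<sigma> \<leadsto> \<tau>)" "g \<in> dom M (\<rho> \<leadsto> \<sigma>)" "a \<in> dom M \<rho>"
  shows "con M (CS \<rho> \<sigma> \<tau>) \<bullet> f \<bullet> g \<bullet> a = f \<bullet> a \<bullet> (g \<bullet> a)"
proof -
  let ?f = "Var (0, \<rho> \<leadsto> \<sigma> \<leadsto> \<tau>)" and ?g = "Var (1, \<rho> \<leadsto> \<sigma>)" and ?a = "Var (2, \<rho>)"
  let ?s = "Con (CS \<rho> \<sigma> \<tau>) \<cdot> ?f \<cdot> ?g \<cdot> ?a" and ?t = "?f \<cdot> ?a \<cdot> (?g \<cdot> ?a)"
  let ?e = "d0((0, \<rho> \<leadsto> \<sigma> \<leadsto> \<tau>) := f, (1, \<rho> \<leadsto> \<sigma>) := g, (2, \<rho>) := a)"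
  have "sat M (eq \<tau> ?s ?t) ?e"
    using assms by (intro axiom) (auto simp: axioms_def EPRA.S)
  moreover have "val M ?e ?s \<in> dom M \<tau>" by (rule val_dom) (use assms in auto)
  moreover have "val M ?e ?t \<in> dom M \<tau>" by (rule val_dom) (use assms in auto)
  ultimately show ?thesis using EQ_imp_eq[of "val M ?e ?s" \<tau> "val M ?e ?t"] by simp
qed

text \<open>Beta reduction as a true identity: the combinator axioms state only extensional
  equality, which is identity in a normal model. From here on, functionals written with
  \<open>lam\<close> are evaluated by the simplifier.\<close>

lemma val_lam_typed:
  "env M e \<Longrightarrow> tyof t = Some \<tau> \<Longrightarrow> a \<in> dom M (snd v) \<Longrightarrow>
   val M e (lam v t) \<bullet> a = val M (e(v := a)) t"
proof (induction t arbitrary: \<tau>)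
  case (Var w)
  let ?\<rho> = "snd v"
  have "con M (CK ?\<rho> ?\<rho>) \<bullet> a \<in> dom M (?\<rho> \<leadsto> ?\<rho>)" using Var.prems by (intro app_dom[of _ ?\<rho>]) auto
  moreover have "e w \<in> dom M (snd w)" using Var.prems(1) unfolding env_def by blast
  ultimately show ?case using Var.prems by (auto simp: lam.simps S_eq K_eq)
next
  case (Con c)
  then show ?case by (simp add: lam.simps K_eq)
next
  case (App t u)
  then obtain \<sigma> where ty: "tyof t = Some (\<sigma> \<leadsto> \<tau>)" "tyof u = Some \<sigma>" by auto
  then have "val M e (lam v t) \<bullet> a = val M (e(v := a)) t" "val M e (lam v u) \<bullet> a = val M (e(v := a)) u"
    using App by blast+
  then show "val M e (lam v (t \<cdot> u)) \<bullet> a = val M (e(v := a)) (t \<cdot> u)"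
    using App.prems ty by (simp add: lam.simps S_eq tyof.simps(3) del: tyof_App_iff)
qed

lemma val_lam [simp]:
  "env M e \<Longrightarrow> tyof t \<noteq> None \<Longrightarrow> a \<in> dom M (snd v) \<Longrightarrow>
   val M e (lam v t) \<bullet> a = val M (e(v := a)) t"
  using val_lam_typed[of e t _ a v] by auto

lemma std_app: "f \<in> dom M (\<sigma> \<leadsto> \<tau>) \<Longrightarrow> a \<in> dom M \<sigma> \<Longrightarrow> std M f \<Longrightarrow> std M a \<Longrightarrow> std M (f \<bullet> a)"
  using axiom[of "St (Var (0, \<sigma> \<leadsto> \<tau>)) \<^bold>\<and> St (Var (1, \<sigma>)) \<^bold>\<longrightarrow> St (Var (0, \<sigma> \<leadsto> \<tau>) \<cdot> Var (1, \<sigma>))"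
      "d0((0, \<sigma> \<leadsto> \<tau>) := f, (1, \<sigma>) := a)"]
  by (simp add: axioms_def Tst.st_app)

lemma std_con [simp]: "std M (con M c)"
  using axiom[of "St (Con c)" d0] by (simp add: axioms_def Tst.st_closed)

text \<open>Closed constants are standard and application preserves standardness. Thus a functional
  written as a term is standard as soon as its parameters are.\<close>

lemma std_val: "env M e \<Longrightarrow> tyof t = Some \<tau> \<Longrightarrow> (\<And>v. v \<in> fvt t \<Longrightarrow> std M (e v)) \<Longrightarrow> std M (val M e t)"
proof (induction t arbitrary: \<tau>)
  case (App t u)
  then obtain \<sigma> where ty: "tyof t = Some (\<sigma> \<leadsto> \<tau>)" "tyof u = Some \<sigma>" by auto
  then have "val M e t \<in> dom M (\<sigma> \<leadsto> \<tau>)" "val M e u \<in> dom M \<sigma>" using App.prems by auto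
  moreover have "std M (val M e t)" "std M (val M e u)" using App ty by auto
  ultimately show ?case using std_app by simp
qed auto

lemma sc_dom [simp]: "n \<in> N \<Longrightarrow> sc n \<in> N"
  by (rule app_dom[of _ TN]) auto

lemma sc_neq_zr [simp]: "n \<in> N \<Longrightarrow> sc n \<noteq> zr" "n \<in> N \<Longrightarrow> zr \<noteq> sc n"
  using axiom[of "\<^bold>\<not> (suc (Var (0, TN)) \<^bold>= zero)" "d0((0, TN) := n)"]
  by (auto simp: axioms_def EPRA.suc_nonzero)

lemma rec_dom [simp]:
  "n \<in> N \<Longrightarrow> y \<in> N \<Longrightarrow> z \<in> dom M (TN \<leadsto> TN \<leadsto> TN) \<Longrightarrow> con M CRec \<bullet> n \<bullet> y \<bullet> z \<in> N"
  by (rule app_dom[of _ "TN \<leadsto> TN \<leadsto> TN"], rule app_dom[of _ TN], rule app_dom[of _ TN]) auto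

lemma rec_zr [simp]:
  "y \<in> N \<Longrightarrow> z \<in> dom M (TN \<leadsto> TN \<leadsto> TN) \<Longrightarrow> con M CRec \<bullet> zr \<bullet> y \<bullet> z = y"
  using axiom[of "Con CRec \<cdot> zero \<cdot> Var (0, TN) \<cdot> Var (0, TN \<leadsto> TN \<leadsto> TN) \<^bold>= Var (0, TN)"
      "d0((0, TN) := y, (0, TN \<leadsto> TN \<leadsto> TN) := z)"]
  by (simp add: axioms_def EPRA.rec_zero)

lemma rec_sc [simp]:
  "n \<in> N \<Longrightarrow> y \<in> N \<Longrightarrow> z \<in> dom M (TN \<leadsto> TN \<leadsto> TN) \<Longrightarrow>
   con M CRec \<bullet> sc n \<bullet> y \<bullet> z = z \<bullet> (con M CRec \<bullet> n \<bullet> y \<bullet> z) \<bullet> n"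
  using axiom[of "Con CRec \<cdot> suc (Var (1, TN)) \<cdot> Var (0, TN) \<cdot> Var (0, TN \<leadsto> TN \<leadsto> TN) \<^bold>=
      Var (0, TN \<leadsto> TN \<leadsto> TN) \<cdot> (Con CRec \<cdot> Var (1, TN) \<cdot> Var (0, TN) \<cdot> Var (0, TN \<leadsto> TN \<leadsto> TN)) \<cdot> Var (1, TN)"
      "d0((1, TN) := n, (0, TN) := y, (0, TN \<leadsto> TN \<leadsto> TN) := z)"]
  by (simp add: axioms_def EPRA.rec_suc)

text \<open>Induction is available for quantifier-free formulas only, so each claim proved by it
  below is phrased by connectives over term equations. Parameters, possibly nonstandard, enter
  through e.\<close>

lemma nat_ind:
  assumes "qf A" "wff A" "env M e" "n \<in> N" "sat M A (e((0, TN) := zr))"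
    and step: "\<And>k. k \<in> N \<Longrightarrow> sat M A (e((0, TN) := k)) \<Longrightarrow> sat M A (e((0, TN) := sc k))"
  shows "sat M A (e((0, TN) := n))"
proof -
  let ?x = "(0, TN)"
  have ff: "free_for s ?x A" for s using free_for_disjoint qf_bv[OF assms(1)] by simp
  have "sat M (subst ?x zero A \<^bold>\<and> (\<^bold>\<forall>?x. (A \<^bold>\<longrightarrow> subst ?x (suc (Var ?x)) A)) \<^bold>\<longrightarrow> (\<^bold>\<forall>?x. A)) e"
    using assms by (intro axiom) (auto simp: axioms_def EPRA.qf_induction)
  then show ?thesis using assms by (simp add: sat_subst ff)
qed

section \<open>Cut-off subtraction, addition and order\<close>

definition pd :: "'a \<Rightarrow> 'a" where "pd n = val M d0 predec \<bullet> n"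

lemma pd_dom [simp]: "n \<in> N \<Longrightarrow> pd n \<in> N"
  unfolding pd_def by (rule app_dom[of _ TN]) auto

lemma pd_zr [simp]: "pd zr = zr"
  by (simp add: pd_def predec_def tyof.simps(3))

lemma pd_sc [simp]: "n \<in> N \<Longrightarrow> pd (sc n) = n"
  by (simp add: pd_def predec_def tyof.simps(3))

abbreviation mo where "mo \<equiv> MON M"

lemma mo_zr [simp]: "a \<in> N \<Longrightarrow> mo a zr = a"
  by (simp add: MON_def val_closed_dom)

lemma mo_sc [simp]: "a \<in> N \<Longrightarrow> b \<in> N \<Longrightarrow> mo a (sc b) = pd (mo a b)"
proof -
  assume "a \<in> N" "b \<in> N"
  moreover have "val M undefined step_pred = val M d0 step_pred" by (rule val_closed) simp
  moreover have "val M d0 step_pred \<bullet> m \<bullet> n = pd m" if "m \<in> N" "n \<in> N" for m n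
    using that val_closed[of predec M _ d0] by (simp add: step_pred_def pd_def tyof.simps(3))
  ultimately show ?thesis by (simp add: MON_def)
qed

lemma LT_iff: "LT M a b \<longleftrightarrow> mo (sc a) b = zr"
  by (simp add: LT_def)

lemma val_predec [simp]: "val M e predec \<bullet> n = pd n"
  using val_closed[of predec M e d0] by (simp add: pd_def)

lemma nat_cases:
  assumes "n \<in> N" obtains "n = zr" | k where "k \<in> N" "n = sc k"
proof -
  have "n = zr \<or> n = sc (pd n)"
    using nat_ind[of "Var (0, TN) \<^bold>= zero \<^bold>\<or> Var (0, TN) \<^bold>= suc (predec \<cdot> Var (0, TN))" d0 n] assms
    by auto
  then show thesis using that assms pd_dom by blast
qed

lemma mo_sc_sc:
  assumes "a \<in> N" "n \<in> N" shows "mo (sc a) (sc n) = mo a n"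
  using nat_ind[of "monus (suc (Var (1, TN))) (suc (Var (0, TN))) \<^bold>= monus (Var (1, TN)) (Var (0, TN))"
      "d0((1, TN) := a)" n] assms by simp

lemma mo_zr_left [simp]: "n \<in> N \<Longrightarrow> mo zr n = zr"
  using nat_ind[of "monus zero (Var (0, TN)) \<^bold>= zero" d0 n] by simp

lemma mo_sc_self: "n \<in> N \<Longrightarrow> mo (sc n) n = sc zr"
proof -
  assume n: "n \<in> N"
  have "mo (sc (sc k)) (sc k) = sc zr" if "k \<in> N" "mo (sc k) k = sc zr" for k
    using that mo_sc_sc[of "sc k" k] by simp
  then show ?thesis
    using nat_ind[of "monus (suc (Var (0, TN))) (Var (0, TN)) \<^bold>= one" d0 n] n by (simp del: mo_sc)
qed

text \<open>Addition serves to undo cut-off subtraction: knowing that k - n is 1, one must be able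
  to conclude that k is the successor of n.\<close>

definition pl :: "'a \<Rightarrow> 'a \<Rightarrow> 'a" where "pl m d = con M CRec \<bullet> m \<bullet> d \<bullet> val M d0 add_step"

lemma pl_zr [simp]: "d \<in> N \<Longrightarrow> pl zr d = d"
  by (simp add: pl_def)

lemma pl_dom [simp]: "m \<in> N \<Longrightarrow> d \<in> N \<Longrightarrow> pl m d \<in> N"
  by (simp add: pl_def)

lemma pl_sc [simp]: "m \<in> N \<Longrightarrow> d \<in> N \<Longrightarrow> pl (sc m) d = sc (pl m d)"
proof -
  assume "m \<in> N" "d \<in> N"
  moreover have "val M d0 add_step \<bullet> a \<bullet> b = sc a" if "a \<in> N" "b \<in> N" for a b
    using that by (simp add: add_step_def tyof.simps(3))
  ultimately show ?thesis by (simp add: pl_def)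
qed

lemma val_pl: "con M CRec \<bullet> m \<bullet> d \<bullet> val M e add_step = pl m d"
  using val_closed[of add_step M e d0] by (simp add: pl_def)

lemma pl_sc_right:
  assumes "m \<in> N" "d \<in> N" shows "pl m (sc d) = sc (pl m d)"
  using nat_ind[of "Con CRec \<cdot> Var (0, TN) \<cdot> suc (Var (1, TN)) \<cdot> add_step \<^bold>=
      suc (Con CRec \<cdot> Var (0, TN) \<cdot> Var (1, TN) \<cdot> add_step)" "d0((1, TN) := d)" m] assms
  by (simp add: val_pl del: rec_sc)

lemma pl_zr_right: "m \<in> N \<Longrightarrow> pl m zr = m"
  using nat_ind[of "Con CRec \<cdot> Var (0, TN) \<cdot> zero \<cdot> add_step \<^bold>= Var (0, TN)" d0 m]
  by (simp add: val_pl del: rec_sc)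

text \<open>When k - n is a successor, passing from n to its successor moves one unit from the
  difference to the other summand, so the sum remains k.\<close>

lemma pl_mo:
  assumes "k \<in> N" "m \<in> N" "mo k m \<noteq> zr" shows "pl m (mo k m) = k"
proof -
  let ?A = "monus (Var (1, TN)) (Var (0, TN)) \<^bold>= zero \<^bold>\<or>
    Con CRec \<cdot> Var (0, TN) \<cdot> monus (Var (1, TN)) (Var (0, TN)) \<cdot> add_step \<^bold>= Var (1, TN)"
  have step: "pd (mo k n) = zr \<or> sc (pl n (pd (mo k n))) = k"
    if "n \<in> N" "mo k n = zr \<or> pl n (mo k n) = k" for n
  proof (rule nat_cases[of "mo k n"])
    fix d assume "d \<in> N" "mo k n = sc d"
    then show ?thesis using that pl_sc_right[of n d] by auto
  qed (use assms that in auto)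
  show ?thesis
    using nat_ind[of ?A "d0((1, TN) := k)" m] assms step by (simp add: val_pl del: rec_sc)
qed

text \<open>If k - n is still positive but its predecessor vanishes, then it is 1, and
  \<open>pl_mo\<close> makes k the successor of n.\<close>

lemma le_cases:
  assumes "k \<in> N" "m \<in> N" "mo k m = zr" shows "LT M k m \<or> k = m"
proof -
  let ?A = "monus (Var (1, TN)) (Var (0, TN)) \<^bold>= zero \<^bold>\<longrightarrow>
    monus (suc (Var (1, TN))) (Var (0, TN)) \<^bold>= zero \<^bold>\<or> Var (1, TN) \<^bold>= Var (0, TN)"
  have step: "mo (sc k) (sc n) = zr \<or> k = sc n"
    if n: "n \<in> N" "mo k n = zr \<longrightarrow> mo (sc k) n = zr \<or> k = n" "mo k (sc n) = zr" for n
  proof (rule nat_cases[of "mo k n"])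
    assume "mo k n = zr"
    then show ?thesis using mo_sc_sc[of k n] assms n by simp
  next
    fix d assume d: "d \<in> N" "mo k n = sc d"
    then have "d = zr" using n assms by simp
    then have "k = sc n" using pl_mo[of k n] d assms n by (simp add: pl_sc_right pl_zr_right)
    then show ?thesis ..
  qed (use assms n in simp)
  have "mo k m = zr \<longrightarrow> mo (sc k) m = zr \<or> k = m"
    using nat_ind[of ?A "d0((1, TN) := k)" m] assms step by (simp del: mo_sc)
  then show ?thesis using assms by (simp add: LT_iff)
qed

lemma mo_self: "n \<in> N \<Longrightarrow> mo n n = zr"
  using mo_sc_self[of n] mo_sc_sc[of n n] by simp

lemma LT_imp_le: "k \<in> N \<Longrightarrow> n \<in> N \<Longrightarrow> LT M k n \<Longrightarrow> mo k n = zr"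
  using mo_sc_sc[of k n] by (simp add: LT_iff)

lemma LT_sc_iff: "i \<in> N \<Longrightarrow> n \<in> N \<Longrightarrow> LT M i (sc n) \<longleftrightarrow> LT M i n \<or> i = n"
  using le_cases[of i n] LT_imp_le[of i n] mo_sc_sc[of i n] mo_self[of n]
  by (auto simp: LT_iff simp del: mo_sc)

lemma LT_not_le:
  assumes "m \<in> N" "n \<in> N" "LT M m n" shows "mo n m \<noteq> zr"
proof -
  let ?A = "monus (suc (Var (0, TN))) (Var (1, TN)) \<^bold>= zero \<^bold>\<longrightarrow>
    \<^bold>\<not> (monus (Var (1, TN)) (Var (0, TN)) \<^bold>= zero)"
  have base: "n \<noteq> zr" if "mo (sc zr) n = zr" using that by auto
  have step: "pd (mo n k) \<noteq> zr" if k: "k \<in> N" "mo (sc k) n = zr \<longrightarrow> mo n k \<noteq> zr"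
    "mo (sc (sc k)) n = zr" for k
  proof (rule nat_cases[of "mo n k"])
    assume "mo n k = zr"
    then show ?thesis using k LT_imp_le[of "sc k" n] assms(2) by (simp add: LT_iff)
  next
    fix d assume d: "d \<in> N" "mo n k = sc d"
    \<comment> \<open>A difference of 1 would make n the successor of k, against the assumption that
      this successor is below n.\<close>
    have "d \<noteq> zr"
    proof
      assume "d = zr"
      then have "n = sc k" using pl_mo[of n k] d assms k by (simp add: pl_sc_right pl_zr_right)
      then show False using k mo_sc_self[of "sc k"] by (simp del: mo_sc)
    qed
    then show ?thesis using d by simp
  qed (use assms k in simp)
  have "mo (sc m) n = zr \<longrightarrow> mo n m \<noteq> zr"
    using nat_ind[of ?A "d0((1, TN) := n)" m] assms base step by simp
  then show ?thesis using assms by (simp add: LT_iff)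
qed

text \<open>Subtraction from 1 is Boolean negation, with zero read as true. All decidable conditions
  below are coded in this way, and \<open>mo_one_le\<close> supplies the bound that STP2 asks
  for.\<close>

lemma mo_one_zr_iff: "n \<in> N \<Longrightarrow> mo (sc zr) n = zr \<longleftrightarrow> n \<noteq> zr"
  by (rule nat_cases[of n]) (use mo_sc_sc[of zr] in \<open>auto simp del: mo_sc\<close>)

lemma mo_one_le: "n \<in> N \<Longrightarrow> mo (mo (sc zr) n) (sc zr) = zr"
  using mo_one_zr_iff[of n] by (cases "n = zr") auto

section \<open>Bounded search\<close>

definition bs :: "'a \<Rightarrow> 'a \<Rightarrow> 'a" where "bs g n = val M d0 search \<bullet> g \<bullet> n"

lemma val_search [simp]: "val M e search \<bullet> g \<bullet> n = bs g n"
  using val_closed[of search M e d0] by (simp add: bs_def)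

lemma bs_dom [simp]: "g \<in> dom M T1 \<Longrightarrow> n \<in> N \<Longrightarrow> bs g n \<in> N"
  unfolding bs_def by (rule app_dom[of _ TN], rule app_dom[of _ T1]) auto

lemma T1_dom: "g \<in> dom M T1 \<Longrightarrow> n \<in> N \<Longrightarrow> g \<bullet> n \<in> N"
  by (rule app_dom)

lemma bs_zr [simp]: "g \<in> dom M T1 \<Longrightarrow> bs g zr = sc zr"
  by (simp add: bs_def search_def tyof.simps(3))

lemma bs_sc:
  assumes "g \<in> dom M T1" "n \<in> N"
  shows "bs g (sc n) = (if g \<bullet> n = zr then zr else bs g n)"
  by (rule nat_cases[OF T1_dom[OF assms]])
    (use assms in \<open>simp_all add: bs_def search_def tyof.simps(3)\<close>)

lemma bs_zero:
  assumes "g \<in> dom M T1" "n \<in> N" "i \<in> N" "LT M i n" "g \<bullet> i = zr"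
  shows "bs g n = zr"
proof -
  let ?A = "monus (suc (Var (1, TN))) (Var (0, TN)) \<^bold>= zero \<^bold>\<longrightarrow>
    search \<cdot> Var (0, T1) \<cdot> Var (0, TN) \<^bold>= zero"
  have "bs g (sc k) = zr" if "k \<in> N" "LT M i k \<longrightarrow> bs g k = zr" "LT M i (sc k)" for k
    using that assms LT_sc_iff[of i k] bs_sc[of g k] by auto
  then have "mo (sc i) n = zr \<longrightarrow> bs g n = zr"
    using nat_ind[of ?A "d0((1, TN) := i, (0, T1) := g)" n] assms by (simp add: LT_iff del: mo_sc)
  then show ?thesis using assms by (simp add: LT_iff)
qed

lemma bs_nonzero:
  assumes "g \<in> dom M T1" "n \<in> N" "\<And>i. i \<in> N \<Longrightarrow> LT M i n \<Longrightarrow> g \<bullet> i \<noteq> zr"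
  shows "bs g n \<noteq> zr"
proof -
  let ?A = "monus (Var (0, TN)) (Var (1, TN)) \<^bold>= zero \<^bold>\<longrightarrow>
    \<^bold>\<not> (search \<cdot> Var (0, T1) \<cdot> Var (0, TN) \<^bold>= zero)"
  have "bs g (sc k) \<noteq> zr" if "k \<in> N" "mo k n = zr \<longrightarrow> bs g k \<noteq> zr" "mo (sc k) n = zr" for k
    using that assms LT_imp_le[of k n] bs_sc[of g k] by (simp add: LT_iff)
  then have "mo n n = zr \<longrightarrow> bs g n \<noteq> zr"
    using nat_ind[of ?A "d0((1, TN) := n, (0, T1) := g)" n] assms by simp
  then show ?thesis using assms mo_self by simp
qed

lemma bs_zero_iff:
  assumes "g \<in> dom M T1" "n \<in> N"
  shows "bs g n = zr \<longleftrightarrow> (\<exists>i \<in> N. LT M i n \<and> g \<bullet> i = zr)"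
  using bs_zero[OF assms] bs_nonzero[OF assms] by blast


section \<open>Separation in normal models\<close>

lemma SOT_model:
  assumes "Y \<in> dom M T2" "std M Y" "g \<in> dom M T1" "Y \<bullet> g = zr"
  shows "\<exists>f \<in> dom M T1. std M f \<and> Y \<bullet> f = zr"
  using assms axiom[of SOT d0] by (auto simp: axioms_def SOT_def Let_def)

lemma STP2_model:
  assumes "Y \<in> dom M T2" "\<And>g. g \<in> dom M T1 \<Longrightarrow> mo (Y \<bullet> g) (sc zr) = zr"
  shows "\<exists>Z \<in> dom M T2. std M Z \<and> (\<forall>g \<in> dom M T1. std M g \<longrightarrow> Z \<bullet> g = Y \<bullet> g)"
proof -
  have "sat M STP2 d0"
    by (rule axiom) (auto simp: axioms_def STP2_def Let_def le2_one_def le_def)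
  then show ?thesis using assms by (auto simp: STP2_def Let_def le2_one_def simp del: mo_sc)
qed

abbreviation elem :: "ty \<Rightarrow> 'a \<Rightarrow> 'a \<Rightarrow> bool" where
  "elem \<sigma> s a \<equiv> \<exists>i \<in> N. LT M i (lenM M \<sigma> s) \<and> a = projM M \<sigma> s i"

lemma len_dom [simp]: "s \<in> dom M (Seq \<sigma>) \<Longrightarrow> lenM M \<sigma> s \<in> N"
  by (rule app_dom[of _ "Seq \<sigma>"]) auto

lemma proj_dom [simp]: "s \<in> dom M (Seq \<sigma>) \<Longrightarrow> i \<in> N \<Longrightarrow> projM M \<sigma> s i \<in> dom M \<sigma>"
  by (rule app_dom[of _ TN], rule app_dom[of _ "Seq \<sigma>"]) auto

lemma EQ_iff: "a \<in> dom M \<sigma> \<Longrightarrow> b \<in> dom M \<sigma> \<Longrightarrow> EQ M \<sigma> a b \<longleftrightarrow> a = b"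
  using EQ_imp_eq EQ_refl by blast

lemma sat_mem_iff:
  assumes "env M e" "tyof z = Some \<sigma>" "tyof s = Some (Seq \<sigma>)"
  shows "sat M (mem \<sigma> z s) e \<longleftrightarrow> elem \<sigma> (val M e s) (val M e z)"
  using assms by (auto simp: EQ_iff)

text \<open>The fixed indices 0, 1, 2 keep the three variables apart even when their types agree.
  Parameters in e may be nonstandard; \<open>separation\<close> relies on this, its parameters being
  built from an idealised sequence.\<close>

lemma idealisation:
  assumes A: "internal A" "wff A" "(2, Seq \<sigma>) \<notin> fv A" and e: "env M e"
    and fin: "\<And>x. x \<in> dom M (Seq \<sigma>) \<Longrightarrow> std M x \<Longrightarrow>
      \<exists>b \<in> dom M \<rho>. \<forall>a \<in> dom M \<sigma>. elem \<sigma> x a \<longrightarrow> sat M A (e((1, \<rho>) := b, (0, \<sigma>) := a))"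
  shows "\<exists>b \<in> dom M \<rho>. \<forall>a \<in> dom M \<sigma>. std M a \<longrightarrow> sat M A (e((1, \<rho>) := b, (0, \<sigma>) := a))"
proof -
  let ?x = "(2, Seq \<sigma>)" and ?y = "(1, \<rho>)" and ?z = "(0, \<sigma>)"
  have "sat M ((\<^bold>\<forall>\<^sup>s\<^sup>t?x. \<^bold>\<exists>?y. \<^bold>\<forall>?z. (mem \<sigma> (Var ?z) (Var ?x) \<^bold>\<longrightarrow> A)) \<^bold>\<longrightarrow> (\<^bold>\<exists>?y. \<^bold>\<forall>\<^sup>s\<^sup>t?z. A)) e"
    using A e by (intro axiom) (auto simp: axioms_def intro!: Ideal.intros)
  moreover have "sat M A (e(?x := x, ?y := b, ?z := a)) = sat M A (e(?y := b, ?z := a))" for x a b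
    by (rule sat_cong) (use A(3) in auto)
  moreover have "sat M (mem \<sigma> (Var ?z) (Var ?x)) (e(?x := x, ?y := b, ?z := a)) \<longleftrightarrow> elem \<sigma> x a"
    if "x \<in> dom M (Seq \<sigma>)" "a \<in> dom M \<sigma>" "b \<in> dom M \<rho>" for x a b
    using that e by (subst sat_mem_iff) auto
  ultimately show ?thesis using fin by (simp del: sat_mem)
qed

text \<open>Idealisation applies because a standard sequence x already contains all members of
  x.\<close>

lemma all_std_seq:
  "\<exists>t \<in> dom M (Seq \<sigma>). \<forall>a \<in> dom M \<sigma>. std M a \<longrightarrow> elem \<sigma> t a"
proof -
  let ?A = "mem \<sigma> (Var (0, \<sigma>)) (Var (1, Seq \<sigma>))"
  have sat: "sat M ?A (d0((1, Seq \<sigma>) := b, (0, \<sigma>) := a)) \<longleftrightarrow> elem \<sigma> b a"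
    if "b \<in> dom M (Seq \<sigma>)" "a \<in> dom M \<sigma>" for a b
    using that by (subst sat_mem_iff) auto
  have "\<exists>b \<in> dom M (Seq \<sigma>). \<forall>a \<in> dom M \<sigma>. std M a \<longrightarrow> sat M ?A (d0((1, Seq \<sigma>) := b, (0, \<sigma>) := a))"
  proof (rule idealisation)
    show "\<exists>b \<in> dom M (Seq \<sigma>). \<forall>a \<in> dom M \<sigma>. elem \<sigma> x a \<longrightarrow> sat M ?A (d0((1, Seq \<sigma>) := b, (0, \<sigma>) := a))"
      if "x \<in> dom M (Seq \<sigma>)" for x
      by (rule bexI[OF _ that]) (use sat that in blast)
  qed (use fv_mem[of \<sigma> "Var (0, \<sigma>)" "Var (1, Seq \<sigma>)"] in auto)
  then show ?thesis using sat by blast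
qed

text \<open>There is no external induction axiom.  Instead, \<open>STP\<^sub>2\<close> standardises the set of
  standard numbers below \<open>m\<close>; were \<open>m\<close> nonstandard, this set would be closed under successor,
  which \<open>SOT\<close> transfers to all numbers, so that internal induction applies.\<close>

lemma std_below:
  assumes n: "n \<in> N" "std M n" and m: "m \<in> N" "LT M m n"
  shows "std M m"
proof (rule ccontr)
  assume nonstd: "\<not> std M m"
  let ?g = "(0, T1)" and ?m = "(0, TN)" and ?Z = "(0, T2)"
  \<comment> \<open>STP2 concerns type 2, so a number k is represented by the functions g with g 0 =
    k. The value Y g is 1 if g 0 is at most m, and 0 otherwise.\<close>
  define Y where "Y = val M (d0(?m := m)) (lam ?g (monus one (monus (Var ?g \<cdot> zero) (Var ?m))))"
  have Y: "Y \<in> dom M T2" using m by (simp add: Y_def tyof.simps(3))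
  have Yap: "Y \<bullet> g = mo (sc zr) (mo (g \<bullet> zr) m)" if "g \<in> dom M T1" for g
    using that m by (simp add: Y_def tyof.simps(3))
  obtain Z where Z: "Z \<in> dom M T2" "std M Z" "\<And>g. g \<in> dom M T1 \<Longrightarrow> std M g \<Longrightarrow> Z \<bullet> g = Y \<bullet> g"
    using STP2_model[OF Y] Yap mo_one_le T1_dom m by auto
  let ?c = "\<lambda>k. con M (CK TN TN) \<bullet> k"
  have c: "?c k \<in> dom M T1" "?c k \<bullet> zr = k" if "k \<in> N" for k
    using that by (auto simp: K_eq intro!: app_dom[of _ TN T1])
  have c_std: "std M (?c k)" if "k \<in> N" "std M k" for k
    using that by (intro std_app[of _ TN T1]) auto
  have sc_std: "std M (sc k)" if "k \<in> N" "std M k" for k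
    using that by (intro std_app[of _ TN TN]) auto
  have Zc: "Z \<bullet> ?c k = mo (sc zr) (mo k m)" if "k \<in> N" "std M k" for k
    using Z(3)[OF c(1) c_std] Yap[OF c(1)] c(2) that by simp
  have ZN: "Z \<bullet> f \<in> N" if "f \<in> dom M T1" for f using app_dom[OF Z(1) that] .
  \<comment> \<open>U vanishes at g exactly when Z is nonzero at g 0 but zero at its successor, that
    is, where closure under successor fails. It is standard because Z is, so SOT applies.\<close>
  define U where "U = val M (d0(?Z := Z)) (lam ?g (Con CRec \<cdot> (Var ?Z \<cdot> (Con (CK TN TN) \<cdot> (Var ?g \<cdot> zero))) \<cdot> one \<cdot>
    lam (1, TN) (lam (2, TN) (Var ?Z \<cdot> (Con (CK TN TN) \<cdot> suc (Var ?g \<cdot> zero))))))"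
  have U: "U \<in> dom M T2" using Z by (simp add: U_def tyof.simps(3))
  have U_std: "std M U" unfolding U_def
    by (rule std_val[of _ _ T2]) (use Z in \<open>auto simp: tyof.simps(3)\<close>)
  have Uap: "U \<bullet> g = (if Z \<bullet> ?c (g \<bullet> zr) = zr then sc zr else Z \<bullet> ?c (sc (g \<bullet> zr)))"
    if g: "g \<in> dom M T1" for g
  proof -
    have k: "g \<bullet> zr \<in> N" using g T1_dom by simp
    show ?thesis
      by (rule nat_cases[OF ZN[OF c(1)[OF k]]])
        (use g Z k ZN c in \<open>simp_all add: U_def tyof.simps(3)\<close>)
  qed
  have no_zero: "U \<bullet> g \<noteq> zr" if g: "g \<in> dom M T1" for g
  proof
    assume "U \<bullet> g = zr"
    then obtain f where f: "f \<in> dom M T1" "std M f" "U \<bullet> f = zr"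
      using SOT_model[OF U U_std g] by blast
    let ?k = "f \<bullet> zr"
    have k: "?k \<in> N" "std M ?k" using f T1_dom std_app[of f TN TN] by auto
    have "Z \<bullet> ?c ?k \<noteq> zr" "Z \<bullet> ?c (sc ?k) = zr" using Uap[OF f(1)] f(3) by (auto split: if_splits)
    then have "mo ?k m = zr" "mo (sc ?k) m \<noteq> zr"
      using Zc[OF k] Zc[OF sc_dom[OF k(1)] sc_std[OF k]] mo_one_zr_iff k m by auto
    \<comment> \<open>At most m, with a successor that is not: only m itself is left.\<close>
    then have "?k = m" using le_cases[of ?k m] k m by (simp add: LT_iff)
    then show False using nonstd k by simp
  qed
  have step: "Z \<bullet> ?c (sc k) \<noteq> zr" if "k \<in> N" "Z \<bullet> ?c k \<noteq> zr" for k
    using no_zero[OF c(1)[OF that(1)]] Uap[OF c(1)[OF that(1)]] c(2) that by simp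
  have base: "Z \<bullet> ?c zr \<noteq> zr" using Zc[of zr] m mo_one_zr_iff[of zr] by simp
  have "Z \<bullet> ?c n \<noteq> zr"
    using nat_ind[of "\<^bold>\<not> (Var ?Z \<cdot> (Con (CK TN TN) \<cdot> Var (0, TN)) \<^bold>= zero)" "d0(?Z := Z)" n] Z n base step
    by simp
  \<comment> \<open>Z agrees with Y at standard arguments only, so the standardness of n is needed
    to read its value as n being at most m.\<close>
  then have "mo n m = zr" using Zc[OF n] mo_one_zr_iff n m by auto
  then show False using LT_not_le m n by blast
qed

text \<open>The index of a member lies below the standard length, hence is standard by
  \<open>std_below\<close>, and projection preserves standardness.\<close>

lemma std_elem: "x \<in> dom M (Seq \<sigma>) \<Longrightarrow> std M x \<Longrightarrow> elem \<sigma> x a \<Longrightarrow> std M a"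
proof -
  assume x: "x \<in> dom M (Seq \<sigma>)" "std M x" and "elem \<sigma> x a"
  then obtain i where i: "i \<in> N" "LT M i (lenM M \<sigma> x)" "a = projM M \<sigma> x i" by blast
  have "std M (lenM M \<sigma> x)" using x by (intro std_app[of _ "Seq \<sigma>" TN]) auto
  then have "std M i" using std_below[of "lenM M \<sigma> x" i] i x by simp
  moreover have "con M (CProj \<sigma>) \<bullet> x \<in> dom M (TN \<leadsto> \<sigma>)" using x by (intro app_dom[of _ "Seq \<sigma>"]) auto
  moreover have "std M (con M (CProj \<sigma>) \<bullet> x)" using x by (intro std_app[of _ "Seq \<sigma>" "TN \<leadsto> \<sigma>"]) auto
  ultimately show "std M a" using i std_app by simp
qed

abbreviation "TP \<equiv> T2 \<leadsto> T1 \<leadsto> T1 \<leadsto> TN"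

lemma matrix_dom: "p \<in> dom M TP \<Longrightarrow> Y \<in> dom M T2 \<Longrightarrow> h \<in> dom M T1 \<Longrightarrow> f \<in> dom M T1 \<Longrightarrow> p \<bullet> Y \<bullet> h \<bullet> f \<in> N"
  by (meson app_dom)

text \<open>Subtracting the matrix from 1 gives a functional W of h that vanishes exactly at the
  counterexamples. It is standard since p, Y and f are, so by SOT a counterexample yields a standard
  one.\<close>

lemma transfer:
  assumes p: "p \<in> dom M TP" "std M p" and Y: "Y \<in> dom M T2" "std M Y" and f: "f \<in> dom M T1" "std M f"
    and std: "\<And>h. h \<in> dom M T1 \<Longrightarrow> std M h \<Longrightarrow> p \<bullet> Y \<bullet> h \<bullet> f = zr" and h: "h \<in> dom M T1"
  shows "p \<bullet> Y \<bullet> h \<bullet> f = zr"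
proof (rule ccontr)
  assume nz: "p \<bullet> Y \<bullet> h \<bullet> f \<noteq> zr"
  let ?e = "d0((0, TP) := p, (0, T2) := Y, (0, T1) := f)"
  define W where "W = val M ?e (lam (1, T1) (monus one (Var (0, TP) \<cdot> Var (0, T2) \<cdot> Var (1, T1) \<cdot> Var (0, T1))))"
  have W: "W \<in> dom M T2" using p Y f by (simp add: W_def tyof.simps(3))
  have W_std: "std M W" unfolding W_def
    by (rule std_val[of _ _ T2]) (use p Y f in \<open>auto simp: tyof.simps(3)\<close>)
  have Wap: "W \<bullet> k = mo (sc zr) (p \<bullet> Y \<bullet> k \<bullet> f)" if "k \<in> dom M T1" for k
    using that p Y f by (simp add: W_def tyof.simps(3))
  have "W \<bullet> h = zr" using Wap[OF h] nz mo_one_zr_iff matrix_dom p Y f h by simp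
  then obtain k where "k \<in> dom M T1" "std M k" "W \<bullet> k = zr" using SOT_model[OF W W_std h] by blast
  then show False using Wap std mo_one_zr_iff[of zr] by simp
qed

text \<open>The condition has to be one internal functional, so that idealisation and STP2 can be
  applied to it. The sequence t is built in as a parameter, whereas s stays an argument because
  idealisation has yet to choose it.\<close>

lemma bounded_satisfaction:
  assumes p: "p \<in> dom M TP" and t: "t \<in> dom M (Seq T1)"
  obtains d where "d \<in> dom M (Seq T2 \<leadsto> T1 \<leadsto> TN)"
    "\<And>s f. s \<in> dom M (Seq T2) \<Longrightarrow> f \<in> dom M T1 \<Longrightarrow>
       d \<bullet> s \<bullet> f = zr \<longleftrightarrow> (\<exists>Y. elem T2 s Y \<and> (\<forall>h. elem T1 t h \<longrightarrow> p \<bullet> Y \<bullet> h \<bullet> f = zr))"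
proof -
  let ?P = "(0, TP)" and ?t = "(0, Seq T1)" and ?s = "(0, Seq T2)" and ?f = "(0, T1)"
    and ?i = "(0, TN)" and ?j = "(1, TN)"
  \<comment> \<open>Zero means true: \<open>?G\<close> is zero at those j where the matrix fails,
    and \<open>?H\<close> is zero at those i for which the search finds no such failure. The two
    negations turn a search into a universal quantifier.\<close>
  let ?G = "lam ?j (monus one (Var ?P \<cdot> proj T2 (Var ?s) (Var ?i) \<cdot> proj T1 (Var ?t) (Var ?j) \<cdot> Var ?f))"
  let ?H = "lam ?i (monus one (search \<cdot> ?G \<cdot> len T1 (Var ?t)))"
  let ?e = "d0(?P := p, ?t := t)"
  define d where "d = val M ?e (lam ?s (lam ?f (search \<cdot> ?H \<cdot> len T2 (Var ?s))))"
  have "d \<in> dom M (Seq T2 \<leadsto> T1 \<leadsto> TN)" using p t by (simp add: d_def tyof.simps(3))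
  moreover have "d \<bullet> s \<bullet> f = zr \<longleftrightarrow> (\<exists>Y. elem T2 s Y \<and> (\<forall>h. elem T1 t h \<longrightarrow> p \<bullet> Y \<bullet> h \<bullet> f = zr))"
    if s: "s \<in> dom M (Seq T2)" and f: "f \<in> dom M T1" for s f
  proof -
    let ?e1 = "?e(?s := s, ?f := f)"
    let ?h = "val M ?e1 ?H" and ?g = "\<lambda>i. val M (?e1(?i := i)) ?G"
    have h: "?h \<in> dom M T1" and g: "?g i \<in> dom M T1" if "i \<in> N" for i
      using p t s f that by (simp_all add: tyof.simps(3))
    have gap: "?g i \<bullet> j = mo (sc zr) (p \<bullet> projM M T2 s i \<bullet> projM M T1 t j \<bullet> f)" if "i \<in> N" "j \<in> N" for i j
      using p t s f that by (simp add: tyof.simps(3))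
    have hap: "?h \<bullet> i = mo (sc zr) (bs (?g i) (lenM M T1 t))" if "i \<in> N" for i
      using p t s f that by (simp add: tyof.simps(3))
    have "d \<bullet> s \<bullet> f = bs ?h (lenM M T2 s)" using p t s f by (simp add: d_def tyof.simps(3))
    then have "d \<bullet> s \<bullet> f = zr \<longleftrightarrow> (\<exists>i \<in> N. LT M i (lenM M T2 s) \<and> ?h \<bullet> i = zr)"
      using bs_zero_iff[OF h[of zr]] s by simp
    also have "\<dots> \<longleftrightarrow> (\<exists>i \<in> N. LT M i (lenM M T2 s) \<and> bs (?g i) (lenM M T1 t) \<noteq> zr)"
      using hap mo_one_zr_iff bs_dom[OF g] t by (intro bex_cong conj_cong refl) auto
    also have "\<dots> \<longleftrightarrow> (\<exists>i \<in> N. LT M i (lenM M T2 s) \<and>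
        (\<forall>j \<in> N. LT M j (lenM M T1 t) \<longrightarrow> p \<bullet> projM M T2 s i \<bullet> projM M T1 t j \<bullet> f = zr))"
    proof (intro bex_cong conj_cong refl)
      fix i assume i: "i \<in> N"
      have "?g i \<bullet> j \<noteq> zr \<longleftrightarrow> p \<bullet> projM M T2 s i \<bullet> projM M T1 t j \<bullet> f = zr" if "j \<in> N" for j
        using gap[OF i that] mo_one_zr_iff matrix_dom[OF p] s t f i that by simp
      then show "bs (?g i) (lenM M T1 t) \<noteq> zr \<longleftrightarrow>
          (\<forall>j \<in> N. LT M j (lenM M T1 t) \<longrightarrow> p \<bullet> projM M T2 s i \<bullet> projM M T1 t j \<bullet> f = zr)"
        using bs_zero_iff[OF g[OF i] len_dom[OF t]] by blast
    qed
    finally show ?thesis by blast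
  qed
  ultimately show thesis using that by blast
qed

definition sat_std :: "'a \<Rightarrow> 'a \<Rightarrow> 'a \<Rightarrow> bool" where
  "sat_std p Y f \<longleftrightarrow> (\<forall>h \<in> dom M T1. std M h \<longrightarrow> p \<bullet> Y \<bullet> h \<bullet> f = zr)"

text \<open>The idealised sequence \<open>s\<close> contains all standard \<open>Y\<close>, but also nonstandard ones.  Hence it is
  required in addition that no standard \<open>f\<close> is put on both sides by members of \<open>s\<close>.  A standard \<open>f\<close>
  is coded by the functional \<open>z\<close> with \<open>z g = f (g 0)\<close>, so that one idealised variable suffices.\<close>

theorem separation:
  assumes p: "p \<in> dom M TP" "std M p" and q: "q \<in> dom M TP" "std M q"
    and disj: "\<And>f X Y. \<lbrakk>f \<in> dom M T1; std M f; X \<in> dom M T2; std M X; Y \<in> dom M T2; std M Y;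
      sat_std p X f; sat_std q Y f\<rbrakk> \<Longrightarrow> False"
  shows "\<exists>Z \<in> dom M T2. std M Z \<and> (\<forall>f \<in> dom M T1. std M f \<longrightarrow> (\<forall>Y \<in> dom M T2. std M Y \<longrightarrow>
      (sat_std p Y f \<longrightarrow> Z \<bullet> f = sc zr) \<and> (sat_std q Y f \<longrightarrow> Z \<bullet> f = zr)))"
proof -
  obtain t where t: "t \<in> dom M (Seq T1)" "\<And>h. h \<in> dom M T1 \<Longrightarrow> std M h \<Longrightarrow> elem T1 t h"
    using all_std_seq[of T1] by blast
  obtain dp where dp: "dp \<in> dom M (Seq T2 \<leadsto> T1 \<leadsto> TN)"
    "\<And>s f. s \<in> dom M (Seq T2) \<Longrightarrow> f \<in> dom M T1 \<Longrightarrow>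
       dp \<bullet> s \<bullet> f = zr \<longleftrightarrow> (\<exists>Y. elem T2 s Y \<and> (\<forall>h. elem T1 t h \<longrightarrow> p \<bullet> Y \<bullet> h \<bullet> f = zr))"
    using bounded_satisfaction[OF p(1) t(1)] by blast
  obtain dq where dq: "dq \<in> dom M (Seq T2 \<leadsto> T1 \<leadsto> TN)"
    "\<And>s f. s \<in> dom M (Seq T2) \<Longrightarrow> f \<in> dom M T1 \<Longrightarrow>
       dq \<bullet> s \<bullet> f = zr \<longleftrightarrow> (\<exists>Y. elem T2 s Y \<and> (\<forall>h. elem T1 t h \<longrightarrow> q \<bullet> Y \<bullet> h \<bullet> f = zr))"
    using bounded_satisfaction[OF q(1) t(1)] by blast
  have elem_T1: "h \<in> dom M T1" if "elem T1 t h" for h using that t(1) by auto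
  \<comment> \<open>t may also have nonstandard members; \<open>transfer\<close> covers
    them.\<close>
  have bounded_iff: "(\<forall>h. elem T1 t h \<longrightarrow> r \<bullet> Y \<bullet> h \<bullet> f = zr) \<longleftrightarrow> sat_std r Y f"
    if "r \<in> dom M TP" "std M r" "Y \<in> dom M T2" "std M Y" "f \<in> dom M T1" "std M f" for r Y f
    unfolding sat_std_def using t(2) elem_T1 transfer[OF that] by blast

  \<comment> \<open>r undoes the coding of f by z: the constant function n has value n at 0, so z
    sends it to f n.\<close>
  define r where "r = val M d0 (lam (0, T2) (lam (0, TN) (Var (0, T2) \<cdot> (Con (CK TN TN) \<cdot> Var (0, TN)))))"
  have r: "r \<in> dom M (T2 \<leadsto> T1)" "std M r"
    unfolding r_def by (simp add: tyof.simps(3), rule std_val[of _ _ "T2 \<leadsto> T1"]) (auto simp: tyof.simps(3))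
  have rap: "r \<bullet> z \<bullet> n = z \<bullet> (con M (CK TN TN) \<bullet> n)" if "z \<in> dom M T2" "n \<in> N" for z n
    using that by (simp add: r_def tyof.simps(3))
  have r_dom: "r \<bullet> z \<in> dom M T1" if "z \<in> dom M T2" for z using app_dom r(1) that by blast
  have r_onto: "\<exists>z \<in> dom M T2. std M z \<and> r \<bullet> z = f" if f: "f \<in> dom M T1" "std M f" for f
  proof -
    define z where "z = val M (d0((0, T1) := f)) (lam (1, T1) (Var (0, T1) \<cdot> (Var (1, T1) \<cdot> zero)))"
    have z: "z \<in> dom M T2" using f by (simp add: z_def tyof.simps(3))
    have "std M z" unfolding z_def
      by (rule std_val[of _ _ T2]) (use f in \<open>auto simp: tyof.simps(3)\<close>)
    moreover have "r \<bullet> z \<bullet> n = f \<bullet> n" if n: "n \<in> N" for n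
    proof -
      have "con M (CK TN TN) \<bullet> n \<in> dom M T1" using n by (intro app_dom[of _ TN]) auto
      then show ?thesis using rap[OF z n] n f by (simp add: z_def tyof.simps(3) K_eq)
    qed
    then have "r \<bullet> z = f" using EQ_imp_eq[OF r_dom[OF z] f(1)] by simp
    ultimately show ?thesis using z by blast
  qed

  let ?z = "(0, T2)" and ?s = "(1, Seq T2)" and ?r = "(0, T2 \<leadsto> T1)"
    and ?dp = "(0, Seq T2 \<leadsto> T1 \<leadsto> TN)" and ?dq = "(1, Seq T2 \<leadsto> T1 \<leadsto> TN)"
  let ?e = "d0(?r := r, ?dp := dp, ?dq := dq)"
  let ?A = "mem T2 (Var ?z) (Var ?s) \<^bold>\<and>
    \<^bold>\<not> (Var ?dp \<cdot> Var ?s \<cdot> (Var ?r \<cdot> Var ?z) \<^bold>= zero \<^bold>\<and> Var ?dq \<cdot> Var ?s \<cdot> (Var ?r \<cdot> Var ?z) \<^bold>= zero)"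
  have e: "env M ?e" using r dp dq by simp
  have sat: "sat M ?A (?e(?s := s, ?z := z)) \<longleftrightarrow>
      elem T2 s z \<and> \<not> (dp \<bullet> s \<bullet> (r \<bullet> z) = zr \<and> dq \<bullet> s \<bullet> (r \<bullet> z) = zr)"
    if "s \<in> dom M (Seq T2)" "z \<in> dom M T2" for s z
    using that e sat_mem_iff[of "?e(?s := s, ?z := z)" "Var ?z" T2 "Var ?s"] by (simp del: sat_mem)
  have "\<exists>s \<in> dom M (Seq T2). \<forall>z \<in> dom M T2. std M z \<longrightarrow> sat M ?A (?e(?s := s, ?z := z))"
  proof (rule idealisation)
    show "\<exists>s \<in> dom M (Seq T2). \<forall>z \<in> dom M T2. elem T2 x z \<longrightarrow> sat M ?A (?e(?s := s, ?z := z))"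
      if x: "x \<in> dom M (Seq T2)" "std M x" for x
    \<comment> \<open>x itself serves as s. Its members are standard by \<open>std_elem\<close>, so
      a conflict among them at the standard function \<open>r \<bullet> z\<close> would contradict
      \<open>disj\<close>.\<close>
    proof (intro bexI[OF _ x(1)] ballI impI)
      fix z assume z: "z \<in> dom M T2" "elem T2 x z"
      have f: "r \<bullet> z \<in> dom M T1" "std M (r \<bullet> z)"
        using r_dom z std_app[OF r(1) z(1) r(2)] std_elem[OF x z(2)] by auto
      have el: "Y \<in> dom M T2 \<and> std M Y" if "elem T2 x Y" for Y using that x std_elem[OF x that] by auto
      have "\<not> (dp \<bullet> x \<bullet> (r \<bullet> z) = zr \<and> dq \<bullet> x \<bullet> (r \<bullet> z) = zr)"
      proof
        assume "dp \<bullet> x \<bullet> (r \<bullet> z) = zr \<and> dq \<bullet> x \<bullet> (r \<bullet> z) = zr"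
        then obtain X Y where X: "elem T2 x X" "\<forall>h. elem T1 t h \<longrightarrow> p \<bullet> X \<bullet> h \<bullet> (r \<bullet> z) = zr"
          and Y: "elem T2 x Y" "\<forall>h. elem T1 t h \<longrightarrow> q \<bullet> Y \<bullet> h \<bullet> (r \<bullet> z) = zr"
          unfolding dp(2)[OF x(1) f(1)] dq(2)[OF x(1) f(1)] by (elim conjE exE)
        have X': "X \<in> dom M T2" "std M X" using el[OF X(1)] by auto
        have Y': "Y \<in> dom M T2" "std M Y" using el[OF Y(1)] by auto
        show False
          using disj[OF f X' Y'] X(2) Y(2) unfolding bounded_iff[OF p X' f] bounded_iff[OF q Y' f] by simp
      qed
      then show "sat M ?A (?e(?s := x, ?z := z))" using sat x z by blast
    qed
    show "(2, Seq T2) \<notin> fv ?A" using fv_mem[of T2 "Var ?z" "Var ?s"] by auto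
  qed (use e in auto)
  then obtain s where s: "s \<in> dom M (Seq T2)"
    and all: "\<And>z. z \<in> dom M T2 \<Longrightarrow> std M z \<Longrightarrow>
      elem T2 s z \<and> \<not> (dp \<bullet> s \<bullet> (r \<bullet> z) = zr \<and> dq \<bullet> s \<bullet> (r \<bullet> z) = zr)"
    using sat by blast
  have no_conflict: "\<not> (dp \<bullet> s \<bullet> f = zr \<and> dq \<bullet> s \<bullet> f = zr)" if "f \<in> dom M T1" "std M f" for f
    using r_onto[OF that] all by blast

  define Z0 where "Z0 = val M (d0(?dp := dp, ?s := s)) (lam (0, T1) (monus one (Var ?dp \<cdot> Var ?s \<cdot> Var (0, T1))))"
  have Z0: "Z0 \<in> dom M T2" using dp s by (simp add: Z0_def tyof.simps(3))
  have Z0ap: "Z0 \<bullet> f = mo (sc zr) (dp \<bullet> s \<bullet> f)" if "f \<in> dom M T1" for f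
    using that dp s by (simp add: Z0_def tyof.simps(3))
  have dpN: "dp \<bullet> s \<bullet> f \<in> N" if "f \<in> dom M T1" for f using dp(1) s that by (meson app_dom)
  obtain Z where Z: "Z \<in> dom M T2" "std M Z" "\<And>f. f \<in> dom M T1 \<Longrightarrow> std M f \<Longrightarrow> Z \<bullet> f = Z0 \<bullet> f"
    using STP2_model[OF Z0] Z0ap mo_one_le dpN by auto
  have "Z \<bullet> f = sc zr"
    if f: "f \<in> dom M T1" "std M f" and Y: "Y \<in> dom M T2" "std M Y" "sat_std p Y f" for f Y
  proof -
    have "dp \<bullet> s \<bullet> f = zr" using dp(2)[OF s f(1)] bounded_iff[OF p Y(1,2) f] Y(3) all[OF Y(1,2)] by blast
    then show ?thesis using Z(3)[OF f] Z0ap[OF f(1)] by simp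
  qed
  moreover have "Z \<bullet> f = zr"
    if f: "f \<in> dom M T1" "std M f" and Y: "Y \<in> dom M T2" "std M Y" "sat_std q Y f" for f Y
  proof -
    have "dq \<bullet> s \<bullet> f = zr" using dq(2)[OF s f(1)] bounded_iff[OF q Y(1,2) f] Y(3) all[OF Y(1,2)] by blast
    then have "dp \<bullet> s \<bullet> f \<noteq> zr" using no_conflict f by blast
    then show ?thesis using Z(3)[OF f] Z0ap[OF f(1)] mo_one_zr_iff dpN[OF f(1)] by simp
  qed
  ultimately show ?thesis using Z(1,2) by blast
qed

end


section \<open>Relativised separation\<close>

lemma fv_relst [simp]: "fv (relst A) = fv A"
  by (induction A) auto

lemma wff_relst [simp]: "wff (relst A) = wff A"
  by (induction A) auto

text \<open>The quantifiers of the closure are relativised too, which makes the parameters of an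
  instance standard. V records the variables already known to be standard while the prefix is peeled
  off.\<close>

lemma sat_relst_foldr_All:
  assumes "env M e" "\<And>v. v \<in> V \<Longrightarrow> std M (e v)"
    and "\<And>e. env M e \<Longrightarrow> (\<And>v. v \<in> V \<union> set xs \<Longrightarrow> std M (e v)) \<Longrightarrow> sat M (relst A) e"
  shows "sat M (relst (foldr All xs A)) e"
  using assms
proof (induction xs arbitrary: e V)
  case (Cons x xs)
  have "sat M (relst (foldr All xs A)) (e(x := a))" if "a \<in> dom M (snd x)" "std M a" for a
    by (rule Cons.IH[where V = "insert x V", OF env_upd]) (use Cons.prems that in auto)
  then show ?case by simp
qed auto

context normal_model
begin

lemma sat_relst_Sigma21:
  assumes "\<psi> \<Colon> TP" "snd Y = T2" "snd h = T1" "snd f = T1" "h \<noteq> f" "Y \<notin> fvt \<psi>" "h \<notin> fvt \<psi>"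
  shows "sat M (relst (\<^bold>\<exists>Y. \<^bold>\<forall>h. \<psi> \<cdot> Var Y \<cdot> Var h \<cdot> Var f \<^bold>= zero)) e \<longleftrightarrow>
    (\<exists>y \<in> dom M T2. std M y \<and> sat_std (val M e \<psi>) y (e f))"
proof -
  have "Y \<noteq> h" "Y \<noteq> f" using assms by auto
  then show ?thesis using assms by (simp add: sat_std_def)
qed

lemma sat_relst_SEP:
  assumes A: "A \<in> Sigma21_SEP_inst" and e: "env M e" and std: "\<And>v. v \<in> fv A \<Longrightarrow> std M (e v)"
  shows "sat M (relst A) e"
  using A
proof cases
  case (1 \<phi> f \<chi> Z)
  obtain \<psi> Y h where \<phi>: "\<phi> = (\<^bold>\<exists>Y. \<^bold>\<forall>h. \<psi> \<cdot> Var Y \<cdot> Var h \<cdot> Var f \<^bold>= zero)"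
    and \<psi>: "\<psi> \<Colon> TP" "snd Y = T2" "snd h = T1" "snd f = T1" "h \<noteq> f" "Y \<notin> fvt \<psi>" "h \<notin> fvt \<psi>" "f \<notin> fvt \<psi>"
    using 1(2) by (cases rule: Sigma21.cases) auto
  obtain \<theta> X k where \<chi>: "\<chi> = (\<^bold>\<exists>X. \<^bold>\<forall>k. \<theta> \<cdot> Var X \<cdot> Var k \<cdot> Var f \<^bold>= zero)"
    and \<theta>: "\<theta> \<Colon> TP" "snd X = T2" "snd k = T1" "snd f = T1" "k \<noteq> f" "X \<notin> fvt \<theta>" "k \<notin> fvt \<theta>" "f \<notin> fvt \<theta>"
    using 1(3) by (cases rule: Sigma21.cases) auto
  have neq: "Z \<noteq> f" using 1(4) \<psi>(4) by auto
  have fv: "fvt \<psi> \<subseteq> fv A" "fvt \<theta> \<subseteq> fv A" using 1(1) \<phi> \<chi> \<psi> \<theta> by auto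
  have Z: "Z \<notin> fvt \<psi>" "Z \<notin> fvt \<theta>" using 1(5) \<phi> \<chi> \<psi> \<theta> by auto
  let ?p = "val M e \<psi>" and ?q = "val M e \<theta>"
  \<comment> \<open>The parameters of both matrices are free in A and hence standard, which makes
    the matrices standard as \<open>separation\<close> requires.\<close>
  have p: "?p \<in> dom M TP" "std M ?p" using e \<psi>(1) std fv by (auto intro!: std_val)
  have q: "?q \<in> dom M TP" "std M ?q" using e \<theta>(1) std fv by (auto intro!: std_val)
  note sat = sat_relst_Sigma21[OF \<psi>(1-7)] sat_relst_Sigma21[OF \<theta>(1-7)]
  show ?thesis
    unfolding 1(1) relst.simps sat.simps \<phi>[symmetric] \<chi>[symmetric]
  proof
    assume "\<forall>a \<in> dom M (snd f). std M (val M (e(f := a)) (Var f)) \<longrightarrow>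
      (sat M (relst \<phi>) (e(f := a)) \<longrightarrow> False) \<or> (sat M (relst \<chi>) (e(f := a)) \<longrightarrow> False)"
    then have "\<not> (sat M (relst \<phi>) (e(f := a)) \<and> sat M (relst \<chi>) (e(f := a)))"
      if "a \<in> dom M T1" "std M a" for a using that \<psi>(4) by auto
    then have disj: "\<not> (sat_std ?p y a \<and> sat_std ?q x a)"
      if "a \<in> dom M T1" "std M a" "y \<in> dom M T2" "std M y" "x \<in> dom M T2" "std M x" for a x y
      using that \<psi>(8) \<theta>(8) unfolding \<phi> \<chi> sat by fastforce
    obtain z where z: "z \<in> dom M T2" "std M z"
      "\<And>a y. \<lbrakk>a \<in> dom M T1; std M a; y \<in> dom M T2; std M y\<rbrakk> \<Longrightarrow>
        (sat_std ?p y a \<longrightarrow> z \<bullet> a = sc zr) \<and> (sat_std ?q y a \<longrightarrow> z \<bullet> a = zr)"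
      using separation[OF p q] disj by blast
    show "\<exists>a \<in> dom M (snd Z). std M (val M (e(Z := a)) (Var Z)) \<and>
      (\<forall>b \<in> dom M (snd f). std M (val M (e(Z := a, f := b)) (Var f)) \<longrightarrow>
        (sat M (relst \<phi>) (e(Z := a, f := b)) \<longrightarrow>
          eq0 M (val M (e(Z := a, f := b)) (Var Z \<cdot> Var f)) (val M (e(Z := a, f := b)) one)) \<and>
        (sat M (relst \<chi>) (e(Z := a, f := b)) \<longrightarrow>
          eq0 M (val M (e(Z := a, f := b)) (Var Z \<cdot> Var f)) (val M (e(Z := a, f := b)) zero)))"
    proof (intro bexI[of _ z] conjI ballI)
      fix b assume "b \<in> dom M (snd f)"
      then show "std M (val M (e(Z := z, f := b)) (Var f)) \<longrightarrow>
        (sat M (relst \<phi>) (e(Z := z, f := b)) \<longrightarrow>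
          eq0 M (val M (e(Z := z, f := b)) (Var Z \<cdot> Var f)) (val M (e(Z := z, f := b)) one)) \<and>
        (sat M (relst \<chi>) (e(Z := z, f := b)) \<longrightarrow>
          eq0 M (val M (e(Z := z, f := b)) (Var Z \<cdot> Var f)) (val M (e(Z := z, f := b)) zero))"
        using z(3)[of b] \<psi>(4,8) \<theta>(8) Z neq unfolding \<phi> \<chi> sat by auto
    qed (use z 1(4) in auto)
  qed
qed

end

lemma wff_Sigma21_SEP_inst: "A \<in> Sigma21_SEP_inst \<Longrightarrow> wff A"
  by (auto elim!: Sigma21_SEP_inst.cases Sigma21.cases)

lemma closed_P0: "B \<in> P0 \<union> {SOT, STP2} \<Longrightarrow> fv B = {}"
  by (auto simp: P0_def closures_def SOT_def STP2_def Let_def le2_one_def le_def)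

theorem theorem4p10:
  shows "\<forall>A \<in> Sigma21_SEP. (P0 \<union> {SOT, STP2} \<turnstile> relst A)"
proof
  fix A assume "A \<in> Sigma21_SEP"
  then obtain xs B where A: "A = foldr All xs B" "B \<in> Sigma21_SEP_inst" "fv A = {}"
    unfolding Sigma21_SEP_def closures_def by blast
  show "P0 \<union> {SOT, STP2} \<turnstile> relst A"
  proof (rule completeness[OF closed_P0])
    show "fv (relst A) = {}" "wff (relst A)" using A wff_Sigma21_SEP_inst by auto
  next
    fix M :: "trm struc" and e
    assume M: "struct M" "env M e"
      and ax: "\<And>B e. \<lbrakk>B \<in> P0 \<union> {SOT, STP2}; wff B; env M e\<rbrakk> \<Longrightarrow> sat M B e"
    interpret P0_model M
    proof
      fix C e assume C: "C \<in> axioms" "wff C" "env M e"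
      show "sat M C e"
      proof (cases "C \<in> {SOT, STP2}")
        case False
        then have "C \<in> EPRA \<union> QFAC10 \<union> Tst \<union> Ideal \<union> HACint" using C(1) by (auto simp: axioms_def)
        \<comment> \<open>P0 contains only closed forms of its axioms; the open instance is
          recovered by stripping the universal prefix semantically.\<close>
        from closure_in_closures[OF this] obtain ys where "foldr All ys C \<in> P0"
          unfolding P0_def by (elim exE)
        then have "sat M (foldr All ys C) e" using ax[of "foldr All ys C" e] C by simp
        then show ?thesis using sat_foldr_AllD C(3) by metis
      qed (use ax C in blast)
    qed (fact M)
    interpret Q: normal_model "quot M" by (rule normal_quot)
    have "sat (quot M) (relst (foldr All xs B)) (\<lambda>v. cls M (snd v) (e v))"
    proof (rule sat_relst_foldr_All[where V = "{}"])
      fix e' assume "env (quot M) e'" "\<And>v. v \<in> {} \<union> set xs \<Longrightarrow> std (quot M) (e' v)"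
      then show "sat (quot M) (relst B) e'"
        using Q.sat_relst_SEP A fv_foldr_All[of xs B] by blast
    qed (use env_quot M in auto)
    then show "sat M (relst A) e" using sat_quot[of e "relst A"] M A wff_Sigma21_SEP_inst by simp
  qed
qed

end
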